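(* Let $X=Spec(A)$ be a smooth affine variety over $\mathbb{C}$ with a bivector field $P\in H^0(X,\Lambda^2T_X)$, let $Y=Spec(B)\subset X$ be a smooth closed subvariety with ideal $I=Ker(A\to B)$ that is coisotropic with respect to $P$, and let $L$ be (the module of global sections of) a line bundle on $Y$. Put $\alpha_X(a,a')=\frac12P(da,da')$. Then there exists a $\mathbb{C}$-linear map $\alpha_L:A\otimes_{\mathbb{C}}L\to L$ such that $$\alpha_L(aa',l)-\alpha_L(a,a'l)+\alpha_X(a,a')\,l-a\,\alpha_L(a',l)=0$$ for all $a,a'\in A$, $l\in L$. Any such $\alpha_L$ vanishes on $I^2\otimes_{\mathbb{C}}L$. Moreover, it may be taken in the form $$\alpha_L(a,l)=\psi(a)\,l+\rho(da,l),$$ where $$\psi\in\mathcal{D}^2_0(A,\mathcal{D}^0(L,L))=\mathcal{D}^2_0(A,B),\qquad \rho\in\mathcal{D}^1_0(A,\mathcal{D}^1(L,L))=Hom_B(\Omega_A,\mathcal{D}^1(L,L)),$$ and both $\psi$ and $\rho$ (viewed as operators on $A$), in addition to vanishing on the constants, also vanish on $I^2\subset A$.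
   Context: $Y$ is coisotropic with respect to $P$ if the image of $P$ in $H^0(Y,\Lambda^2N)$ ($N$ the normal bundle) is zero, i.e. $P(df,dg)\in I$ for all $f,g\in I$. $\Omega_A$ denotes the $B$-module of global sections of $\Omega^1_X|_Y$, and $da$ is regarded in it. $\mathcal{D}^k(F,G)$ denotes ($\mathbb{C}$-linear) algebraic differential operators $F\to G$ of order $\le k$; $\mathcal{D}^k_0(A,G)$ is the subspace of operators vanishing on constants. $\mathcal{D}^k(L,L)$ is considered as a module via the module structure on the target $L$. The notation $\rho(da,l)$ means $\rho(da)(l)$. *)

theory Defs
  imports
    Complex_Main
    "HOL-Library.Poly_Mapping"
    "HOL-Library.Function_Algebras"
    "HOL-Library.FuncSet"
begin

section \<open>Commutative complex algebras and their ideals\<close>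

class complex_alg = comm_ring_1 +
  fixes of_cx :: "complex \<Rightarrow> 'a"
  assumes of_cx_add: "of_cx (c + c') = of_cx c + of_cx c'"
    and of_cx_mult: "of_cx (c * c') = of_cx c * of_cx c'"
    and of_cx_1: "of_cx 1 = 1"

definition complex_alg_hom :: "('a::complex_alg \<Rightarrow> 'b::complex_alg) \<Rightarrow> bool" where
  "complex_alg_hom f \<longleftrightarrow>
     (\<forall>x y. f (x + y) = f x + f y) \<and> (\<forall>x y. f (x * y) = f x * f y) \<and>
     (\<forall>c. f (of_cx c) = of_cx c)"

text \<open>\<open>A\<close>-submodules of the \<open>A\<close>-module \<open>A\<close> are the ideals of \<open>A\<close>.\<close>

lemma module_mult: "module ((*) :: 'a::comm_ring_1 \<Rightarrow> 'a \<Rightarrow> 'a)"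
  by unfold_locales (simp_all add: algebra_simps)

definition ideal_prod :: "'a::comm_ring_1 set \<Rightarrow> 'a set \<Rightarrow> 'a set" where
  "ideal_prod I J = module.span (*) {f * g | f g. f \<in> I \<and> g \<in> J}"

definition prime_ideal :: "'a::comm_ring_1 set \<Rightarrow> bool" where
  "prime_ideal p \<longleftrightarrow>
     module.subspace (*) p \<and> 1 \<notin> p \<and> (\<forall>x y. x * y \<in> p \<longrightarrow> x \<in> p \<or> y \<in> p)"

definition ker :: "('a \<Rightarrow> 'b::zero) \<Rightarrow> 'a set" where
  "ker f = {a. f a = 0}"


section \<open>Smooth affine varieties\<close>

text \<open>A polynomial is a finitely supported map from monomials to coefficients, a monomial being a
  finitely supported map from variables to exponents.\<close>

type_synonym cpoly = "(nat \<Rightarrow>\<^sub>0 nat) \<Rightarrow>\<^sub>0 complex"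

definition cpolys :: "nat \<Rightarrow> cpoly set" where
  "cpolys n = {f. \<forall>m\<in>Poly_Mapping.keys f. Poly_Mapping.keys m \<subseteq> {..<n}}"

definition cpoly_eval :: "(nat \<Rightarrow> 'a::complex_alg) \<Rightarrow> cpoly \<Rightarrow> 'a" where
  "cpoly_eval x f =
     (\<Sum>m\<in>Poly_Mapping.keys f. of_cx (Poly_Mapping.lookup f m) *
        (\<Prod>i\<in>Poly_Mapping.keys m. x i ^ Poly_Mapping.lookup m i))"

definition cpoly_pderiv :: "nat \<Rightarrow> cpoly \<Rightarrow> cpoly" where
  "cpoly_pderiv j f =
     (\<Sum>m\<in>Poly_Mapping.keys f. Poly_Mapping.single (m - Poly_Mapping.single j 1)
        (of_nat (Poly_Mapping.lookup m j) * Poly_Mapping.lookup f m))"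

text \<open>Smoothness of \<open>Spec A\<close> over the complex numbers in the form used by Bosch, Luetkebohmert and
  Raynaud: for a closed embedding \<open>x\<close> of \<open>Spec A\<close> into affine \<open>n\<close>-space and every point \<open>p\<close>, on some
  open neighbourhood (the locus \<open>s \<noteq> 0\<close>) the ideal of \<open>Spec A\<close> is generated by \<open>g 0, ..., g (c - 1)\<close>
  whose differentials are linearly independent over the residue field at \<open>p\<close>. That residue field is
  the fraction field of \<open>A / p\<close>, so independence may be tested with coefficients from \<open>A\<close>. Finite
  type is included; reducedness and regularity of the local rings follow.\<close>

definition smooth_affine :: "'a::complex_alg itself \<Rightarrow> bool" where
  "smooth_affine TYPE('a) \<longleftrightarrow>
     (\<exists>n. \<exists>x :: nat \<Rightarrow> 'a.
        cpoly_eval x ` cpolys n = UNIV \<and>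
        (\<forall>p. prime_ideal p \<longrightarrow>
          (\<exists>c. \<exists>g :: nat \<Rightarrow> cpoly. \<exists>s \<in> cpolys n.
             (\<forall>i<c. g i \<in> cpolys n \<and> cpoly_eval x (g i) = 0) \<and>
             cpoly_eval x s \<notin> p \<and>
             (\<forall>h \<in> cpolys n. cpoly_eval x h = 0 \<longrightarrow>
                (\<exists>q. (\<forall>i<c. q i \<in> cpolys n) \<and> s * h = (\<Sum>i<c. q i * g i))) \<and>
             (\<forall>r :: nat \<Rightarrow> 'a.
                (\<forall>j<n. (\<Sum>i<c. r i * cpoly_eval x (cpoly_pderiv j (g i))) \<in> p) \<longrightarrow>
                (\<forall>i<c. r i \<in> p)))))"


section \<open>Kaehler differentials\<close>

definition pm_scale :: "'a::comm_ring_1 \<Rightarrow> ('k \<Rightarrow>\<^sub>0 'a) \<Rightarrow> ('k \<Rightarrow>\<^sub>0 'a)" where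
  "pm_scale a = Poly_Mapping.map (\<lambda>x. a * x)"

lemma lookup_pm_scale: "Poly_Mapping.lookup (pm_scale a f) k = a * Poly_Mapping.lookup f k"
  unfolding pm_scale_def by transfer (simp add: when_def)

lemma module_pm_scale: "module (pm_scale :: 'a::comm_ring_1 \<Rightarrow> ('k \<Rightarrow>\<^sub>0 'a) \<Rightarrow> _)"
  by unfold_locales
    (auto intro!: poly_mapping_eqI simp: lookup_pm_scale lookup_add algebra_simps)

text \<open>In the free module on the set \<open>A\<close>, the basis element belonging to \<open>a\<close> is \<open>single a 1\<close>; its class
  will be \<open>d a\<close>.\<close>

definition kaehler_rels :: "('a::complex_alg \<Rightarrow>\<^sub>0 'a) set" where
  "kaehler_rels =
     {Poly_Mapping.single (a + b) 1 - Poly_Mapping.single a 1 - Poly_Mapping.single b 1 | a b. True} \<union>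
     {Poly_Mapping.single (a * b) 1 - Poly_Mapping.single b a - Poly_Mapping.single a b | a b. True} \<union>
     {Poly_Mapping.single (of_cx c) 1 | c. True}"

definition kaehler_eq :: "('a::complex_alg \<Rightarrow>\<^sub>0 'a) \<Rightarrow> ('a \<Rightarrow>\<^sub>0 'a) \<Rightarrow> bool" where
  "kaehler_eq u v \<longleftrightarrow> u - v \<in> module.span pm_scale kaehler_rels"

quotient_type (overloaded) 'a kaehler = "'a::complex_alg \<Rightarrow>\<^sub>0 'a" / kaehler_eq
proof (rule equivpI)
  interpret M: module "pm_scale :: 'a \<Rightarrow> ('a \<Rightarrow>\<^sub>0 'a) \<Rightarrow> _"
    by (rule module_pm_scale)
  show "reflp (kaehler_eq :: ('a \<Rightarrow>\<^sub>0 'a) \<Rightarrow> _)"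
    by (auto simp: reflp_def kaehler_eq_def M.span_zero)
  show "symp (kaehler_eq :: ('a \<Rightarrow>\<^sub>0 'a) \<Rightarrow> _)"
    unfolding symp_def kaehler_eq_def using M.span_neg by fastforce
  show "transp (kaehler_eq :: ('a \<Rightarrow>\<^sub>0 'a) \<Rightarrow> _)"
    unfolding transp_def kaehler_eq_def using M.span_add by fastforce
qed

instantiation kaehler :: (complex_alg) ab_group_add
begin

lift_definition zero_kaehler :: "'a kaehler" is 0 .

lift_definition plus_kaehler :: "'a kaehler \<Rightarrow> 'a kaehler \<Rightarrow> 'a kaehler" is "(+)"
  unfolding kaehler_eq_def
  using module.span_add[OF module_pm_scale] by (metis add_diff_add)

lift_definition uminus_kaehler :: "'a kaehler \<Rightarrow> 'a kaehler" is uminus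
  unfolding kaehler_eq_def
  using module.span_neg[OF module_pm_scale] by (metis minus_diff_minus)

lift_definition minus_kaehler :: "'a kaehler \<Rightarrow> 'a kaehler \<Rightarrow> 'a kaehler" is "(-)"
  unfolding kaehler_eq_def
  using module.span_diff[OF module_pm_scale]
  by (metis (no_types, lifting) add_diff_add diff_conv_add_uminus minus_diff_minus)

instance
  by standard
    (transfer, simp add: kaehler_eq_def module.span_zero[OF module_pm_scale] algebra_simps)+

end

lift_definition kscale :: "'a::complex_alg \<Rightarrow> 'a kaehler \<Rightarrow> 'a kaehler" is pm_scale
  unfolding kaehler_eq_def
  using module.span_scale[OF module_pm_scale]
  by (metis module.scale_right_diff_distrib[OF module_pm_scale])

lift_definition kd :: "'a::complex_alg \<Rightarrow> 'a kaehler" is "\<lambda>a. Poly_Mapping.single a 1" .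

lemma module_kscale: "module (kscale :: 'a::complex_alg \<Rightarrow> _)"
proof -
  interpret M: module "pm_scale :: 'a \<Rightarrow> ('a \<Rightarrow>\<^sub>0 'a) \<Rightarrow> _"
    by (rule module_pm_scale)
  show ?thesis
    by unfold_locales
      (transfer, simp add: kaehler_eq_def M.span_zero M.scale_right_distrib M.scale_left_distrib)+
qed


section \<open>Differentials restricted to a closed subvariety\<close>

text \<open>For surjective \<open>\<pi> : A \<rightarrow> B\<close> with kernel \<open>I\<close>, the restriction of the sheaf of differentials of
  \<open>Spec A\<close> to \<open>Spec B\<close> has global sections \<open>\<Omega> \<otimes>\<^sub>A B = \<Omega> / I \<Omega>\<close>. Since \<open>\<pi>\<close> is a term, this quotient is
  not a type; its elements are the cosets \<open>kres \<pi> w\<close>. Its \<open>B\<close>-module structure is determined by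
  \<open>kres \<pi> v + kres \<pi> w = kres \<pi> (v + w)\<close> and \<open>\<pi> a \<cdot> kres \<pi> w = kres \<pi> (a \<cdot> w)\<close>.\<close>

definition kres :: "('a::complex_alg \<Rightarrow> 'b::zero) \<Rightarrow> 'a kaehler \<Rightarrow> 'a kaehler set" where
  "kres \<pi> w = {w'. w' - w \<in> module.span kscale {kscale i v | i v. i \<in> ker \<pi>}}"

definition kd_res :: "('a::complex_alg \<Rightarrow> 'b::zero) \<Rightarrow> 'a \<Rightarrow> 'a kaehler set" where
  "kd_res \<pi> a = kres \<pi> (kd a)"

text \<open>\<open>B\<close>-linear maps from \<open>\<Omega> / I \<Omega>\<close> to a submodule \<open>G\<close> of a \<open>B\<close>-module with scalar
  multiplication \<open>t\<close>.\<close>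

definition hom_kres ::
  "('a::complex_alg \<Rightarrow> 'b::complex_alg) \<Rightarrow> ('b \<Rightarrow> 'g::ab_group_add \<Rightarrow> 'g) \<Rightarrow> 'g set
     \<Rightarrow> ('a kaehler set \<Rightarrow> 'g) set" where
  "hom_kres \<pi> t G =
     {\<rho> \<in> range (kres \<pi>) \<rightarrow>\<^sub>E G.
        (\<forall>v w. \<rho> (kres \<pi> (v + w)) = \<rho> (kres \<pi> v) + \<rho> (kres \<pi> w)) \<and>
        (\<forall>a w. \<rho> (kres \<pi> (kscale a w)) = t (\<pi> a) (\<rho> (kres \<pi> w)))}"


section \<open>Bivector fields and coisotropic subvarieties\<close>

text \<open>On a smooth affine variety the global sections of the exterior square of the tangent bundle
  are the alternating bilinear forms on the differentials.\<close>

definition bivector_field :: "('a::complex_alg kaehler \<Rightarrow> 'a kaehler \<Rightarrow> 'a) \<Rightarrow> bool" where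
  "bivector_field P \<longleftrightarrow>
     (\<forall>v. module_hom kscale (*) (P v)) \<and> (\<forall>w. module_hom kscale (*) (\<lambda>v. P v w)) \<and>
     (\<forall>w. P w w = 0)"

definition coisotropic ::
  "('a::complex_alg \<Rightarrow> 'b::complex_alg) \<Rightarrow> ('a kaehler \<Rightarrow> 'a kaehler \<Rightarrow> 'a) \<Rightarrow> bool" where
  "coisotropic \<pi> P \<longleftrightarrow> (\<forall>f \<in> ker \<pi>. \<forall>g \<in> ker \<pi>. P (kd f) (kd g) \<in> ker \<pi>)"

definition alpha_X :: "('a::complex_alg kaehler \<Rightarrow> 'a kaehler \<Rightarrow> 'a) \<Rightarrow> 'a \<Rightarrow> 'a \<Rightarrow> 'a" where
  "alpha_X P a a' = of_cx (1/2) * P (kd a) (kd a')"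


section \<open>Line bundles\<close>

text \<open>Locally free of rank one: every point \<open>p\<close> has a neighbourhood, the locus \<open>f \<noteq> 0\<close>, over which
  \<open>L\<close> is free with some basis \<open>e\<close>, taken in \<open>L\<close> after clearing denominators. The last two
  conjuncts say that \<open>b \<mapsto> b e\<close> becomes surjective and injective after inverting \<open>f\<close>.\<close>

definition line_bundle :: "('b::comm_ring_1 \<Rightarrow> 'l::ab_group_add \<Rightarrow> 'l) \<Rightarrow> bool" where
  "line_bundle s \<longleftrightarrow> module s \<and>
     (\<forall>p. prime_ideal p \<longrightarrow>
        (\<exists>f e. f \<notin> p \<and>
           (\<forall>l. \<exists>k b. s (f ^ k) l = s b e) \<and>
           (\<forall>b. s b e = 0 \<longrightarrow> (\<exists>k. f ^ k * b = 0))))"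


section \<open>Differential operators\<close>

text \<open>\<open>diff_ops k s t\<close>: operators of order at most \<open>k\<close> between the modules with scalar
  multiplications \<open>s\<close> and \<open>t\<close>, in Grothendieck's sense.\<close>

primrec diff_ops ::
  "nat \<Rightarrow> ('r::complex_alg \<Rightarrow> 'f::ab_group_add \<Rightarrow> 'f) \<Rightarrow> ('r \<Rightarrow> 'g::ab_group_add \<Rightarrow> 'g)
     \<Rightarrow> ('f \<Rightarrow> 'g) set" where
  "diff_ops 0 s t =
     {D. Vector_Spaces.linear (\<lambda>c. s (of_cx c)) (\<lambda>c. t (of_cx c)) D \<and>
         (\<forall>r u. D (s r u) - t r (D u) = 0)}"
| "diff_ops (Suc k) s t =
     {D. Vector_Spaces.linear (\<lambda>c. s (of_cx c)) (\<lambda>c. t (of_cx c)) D \<and>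
         (\<forall>r. (\<lambda>u. D (s r u) - t r (D u)) \<in> diff_ops k s t)}"

text \<open>Operators from \<open>A\<close> to a submodule \<open>G\<close> of the \<open>A\<close>-module with scalar multiplication \<open>t\<close> that
  vanish on constants.\<close>

definition diff_ops0 ::
  "nat \<Rightarrow> ('r::complex_alg \<Rightarrow> 'g::ab_group_add \<Rightarrow> 'g) \<Rightarrow> 'g set \<Rightarrow> ('r \<Rightarrow> 'g) set" where
  "diff_ops0 k t G = {D \<in> diff_ops k (*) t. range D \<subseteq> G \<and> (\<forall>c. D (of_cx c) = 0)}"

text \<open>Scalar multiplication on operators with values in \<open>L\<close> through the target; addition of
  operators is the pointwise addition of functions.\<close>

definition op_scale :: "('b \<Rightarrow> 'l \<Rightarrow> 'l) \<Rightarrow> 'b \<Rightarrow> ('l \<Rightarrow> 'l) \<Rightarrow> ('l \<Rightarrow> 'l)" where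
  "op_scale s b T = (\<lambda>l. s b (T l))"


section \<open>First order deformations of the module structure\<close>

text \<open>A linear map on \<open>A \<otimes> L\<close> (tensor product over the complex numbers) is given as the bilinear map
  \<open>\<alpha>\<close> on \<open>A \<times> L\<close>.\<close>

definition is_alpha_L ::
  "('a::complex_alg \<Rightarrow> 'b::complex_alg) \<Rightarrow> ('a kaehler \<Rightarrow> 'a kaehler \<Rightarrow> 'a)
     \<Rightarrow> ('b \<Rightarrow> 'l::ab_group_add \<Rightarrow> 'l) \<Rightarrow> ('a \<Rightarrow> 'l \<Rightarrow> 'l) \<Rightarrow> bool" where
  "is_alpha_L \<pi> P s \<alpha> \<longleftrightarrow>
     (\<forall>l. Vector_Spaces.linear (\<lambda>c a. of_cx c * a) (\<lambda>c. s (of_cx c)) (\<lambda>a. \<alpha> a l)) \<and>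
     (\<forall>a. Vector_Spaces.linear (\<lambda>c. s (of_cx c)) (\<lambda>c. s (of_cx c)) (\<alpha> a)) \<and>
     (\<forall>a a' l. \<alpha> (a * a') l - \<alpha> a (s (\<pi> a') l) + s (\<pi> (alpha_X P a a')) l
        - s (\<pi> a) (\<alpha> a' l) = 0)"

end

theory Submission
  imports Defs
begin

text \<open>
  For a map of the form \<open>\<alpha>(a, l) = \<psi>(a) l + \<rho>(da, l)\<close> the cocycle equation is an equation between symbols.
  Since \<open>\<rho>(d(a a')) = a \<rho>(da') + a' \<rho>(da)\<close>, it says that the commutator \<open>[\<rho>(da), a']\<close>, which is
  multiplication by an element \<open>S(a, a')\<close> of \<open>B\<close>, equals
  \<open>\<psi>(a a') - a \<psi>(a') - a' \<psi>(a) + P(da, da')/2\<close>. The part coming from \<open>\<psi>\<close> is symmetric. So what is needed is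
  a biderivation \<open>S\<close> with values in \<open>B\<close> that vanishes if its second argument is in \<open>I\<close> and has
  antisymmetric part \<open>P/2\<close>, together with a lift of \<open>S\<close> to first order operators on \<open>L\<close> and a second
  order operator \<open>\<psi>\<close> whose symbol is the symmetric part of \<open>S\<close>.

  Smoothness of \<open>Y\<close> provides elements \<open>x\<^sub>k\<close> of \<open>B\<close> and derivations \<open>\<theta>\<^sub>k\<close> of \<open>B\<close> with
  \<open>\<delta> b = \<Sum>\<^sub>k \<theta>\<^sub>k(b) \<delta>(x\<^sub>k)\<close> for all derivations \<open>\<delta>\<close> (lemma \<open>smooth_affine_dual_basis\<close>). Lifting \<open>x\<^sub>k\<close> to \<open>y\<^sub>k\<close> in
  \<open>A\<close> splits the restricted differentials \<open>\<Omega>\<^sub>A\<close> into the conormal part and the differentials of \<open>Y\<close>. Since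
  \<open>Y\<close> is coisotropic, \<open>P\<close> vanishes on pairs of conormal vectors, so it is determined by the functions
  \<open>P(da, dy\<^sub>k)\<close> (lemma \<open>coisotropic_decomposition\<close>), and one may take
  \<open>S(a, a') = \<Sum>\<^sub>k \<sigma>\<^sub>k(a) \<theta>\<^sub>k(a')\<close> with \<open>\<sigma>\<^sub>k(a) = P(da, dy\<^sub>k) - (\<Sum>\<^sub>j \<theta>\<^sub>j(a) P(dy\<^sub>j, dy\<^sub>k))/2\<close>.
  The line bundle has covariant derivatives \<open>D\<^sub>k\<close> along \<open>\<theta>\<^sub>k\<close> (lemma \<open>line_bundle_connection\<close>), hence
  \<open>\<rho>(da) = \<Sum>\<^sub>k \<sigma>\<^sub>k(a) D\<^sub>k\<close> has the symbol \<open>S\<close>. The symmetric part of \<open>S\<close> is the symbol of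
  \<open>\<psi>(a) = (\<Sum>\<^sub>k \<theta>\<^sub>k(P(da, dy\<^sub>k)))/2\<close>, a sum of compositions of two derivations
  (lemma \<open>deformation_data_exist\<close>). For \<open>f\<close> and \<open>g\<close> in \<open>I\<close>, both \<open>\<rho>(d(f g))\<close> and \<open>\<psi>(f g)\<close> vanish by the
  product rules; for an arbitrary \<open>\<alpha>\<^sub>L\<close> the vanishing on \<open>f g\<close> can be read off from the cocycle equation.

  The identification of \<open>\<D>\<^sup>0(L, L)\<close> with \<open>B\<close> holds because \<open>L\<close> is locally free of rank one, and the
  description of the operators \<open>\<rho>\<close> by \<open>\<Omega>\<^sub>A\<close> is the universal property of the differentials. All local
  information is made global by the fact that an ideal contained in no prime ideal contains \<open>1\<close>.
\<close>

section \<open>Derivations\<close>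

lemma of_cx_0 [simp]: "of_cx 0 = (0::'r::complex_alg)"
  using of_cx_add[of 0 0, where ?'a='r] by simp

text \<open>For an algebra map \<open>\<pi> : A \<rightarrow> B\<close> and a \<open>B\<close>-module with scalar multiplication \<open>t\<close>, derivations of \<open>A\<close> with
  values in that module are obtained for \<open>s = (\<lambda>a. t (\<pi> a))\<close>. Linearity over the complex numbers follows
  from the product rule and the vanishing on constants.\<close>

definition derivation ::
  "('r::complex_alg \<Rightarrow> 'm::ab_group_add \<Rightarrow> 'm) \<Rightarrow> ('r \<Rightarrow> 'm) \<Rightarrow> bool" where
  "derivation s \<delta> \<longleftrightarrow>
     (\<forall>x y. \<delta> (x + y) = \<delta> x + \<delta> y) \<and> (\<forall>x y. \<delta> (x * y) = s x (\<delta> y) + s y (\<delta> x)) \<and>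
     (\<forall>c. \<delta> (of_cx c) = 0)"

lemma
  assumes "derivation s \<delta>"
  shows derivation_add: "\<delta> (x + y) = \<delta> x + \<delta> y"
    and derivation_mult: "\<delta> (x * y) = s x (\<delta> y) + s y (\<delta> x)"
    and derivation_of_cx: "\<delta> (of_cx c) = 0"
    and derivation_0: "\<delta> 0 = 0"
    and derivation_1: "\<delta> 1 = 0"
  using assms unfolding derivation_def by (metis of_cx_0 of_cx_1)+

lemma derivation_sum:
  assumes "derivation s \<delta>"
  shows "\<delta> (sum f K) = (\<Sum>k\<in>K. \<delta> (f k))"
  by (induction K rule: infinite_finite_induct)
    (simp_all add: derivation_0[OF assms] derivation_add[OF assms])

lemma derivation_diff:
  assumes "derivation s \<delta>"
  shows "\<delta> (x - y) = \<delta> x - \<delta> y"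
  using derivation_add[OF assms, of "x - y" y] by (simp add: algebra_simps)

lemma derivationI:
  assumes "\<And>x y. \<delta> (x + y) = \<delta> x + \<delta> y" and "\<And>x y. \<delta> (x * y) = s x (\<delta> y) + s y (\<delta> x)"
    and "\<And>c. \<delta> (of_cx c) = 0"
  shows "derivation s \<delta>"
  using assms unfolding derivation_def by blast

section \<open>Polynomials and their partial derivatives at a point\<close>

lemma poly_mapping_sum_single:
  fixes f :: "'k \<Rightarrow>\<^sub>0 'm::comm_monoid_add"
  shows "(\<Sum>m\<in>Poly_Mapping.keys f. Poly_Mapping.single m (Poly_Mapping.lookup f m)) = f"
proof (rule poly_mapping_eqI)
  fix k
  show "Poly_Mapping.lookup (\<Sum>m\<in>Poly_Mapping.keys f. Poly_Mapping.single m (Poly_Mapping.lookup f m)) k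
      = Poly_Mapping.lookup f k"
    by (cases "k \<in> Poly_Mapping.keys f")
      (simp_all add: lookup_sum lookup_single when_def not_in_keys_iff_lookup_eq_zero)
qed

lemma poly_mapping_add_induct:
  fixes f :: "'k \<Rightarrow>\<^sub>0 'm::comm_monoid_add"
  assumes "P 0" and "\<And>f g. P f \<Longrightarrow> P g \<Longrightarrow> P (f + g)" and "\<And>m c. P (Poly_Mapping.single m c)"
  shows "P f"
proof -
  have "P (\<Sum>m\<in>K. Poly_Mapping.single m (Poly_Mapping.lookup f m))" for K
    by (induction K rule: infinite_finite_induct) (simp_all add: assms)
  from this[of "Poly_Mapping.keys f"] show ?thesis
    by (simp add: poly_mapping_sum_single)
qed

definition mono_eval :: "(nat \<Rightarrow> 'a::complex_alg) \<Rightarrow> (nat \<Rightarrow>\<^sub>0 nat) \<Rightarrow> 'a" where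
  "mono_eval x m = (\<Prod>i\<in>Poly_Mapping.keys m. x i ^ Poly_Mapping.lookup m i)"

text \<open>The partial derivative of a monomial, evaluated at \<open>x\<close>. Only values of derivatives are needed
  below, so the product rule is stated for \<open>eval_pderiv\<close>, a derivation over the evaluation map, and
  not for \<open>cpoly_pderiv\<close> itself.\<close>

definition mono_deriv :: "(nat \<Rightarrow> 'a::complex_alg) \<Rightarrow> nat \<Rightarrow> (nat \<Rightarrow>\<^sub>0 nat) \<Rightarrow> 'a" where
  "mono_deriv x j m =
     of_nat (Poly_Mapping.lookup m j) * mono_eval x (m - Poly_Mapping.single j 1)"

abbreviation eval_pderiv :: "(nat \<Rightarrow> 'a::complex_alg) \<Rightarrow> nat \<Rightarrow> cpoly \<Rightarrow> 'a" where
  "eval_pderiv x j f \<equiv> cpoly_eval x (cpoly_pderiv j f)"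

lemma mono_eval_superset:
  assumes "finite V" "Poly_Mapping.keys m \<subseteq> V"
  shows "mono_eval x m = (\<Prod>i\<in>V. x i ^ Poly_Mapping.lookup m i)"
  unfolding mono_eval_def
  by (rule prod.mono_neutral_left[OF assms]) (simp add: not_in_keys_iff_lookup_eq_zero)

lemma mono_eval_0 [simp]: "mono_eval x 0 = 1"
  by (simp add: mono_eval_def)

lemma mono_eval_single_1 [simp]: "mono_eval x (Poly_Mapping.single j 1) = x j"
  by (simp add: mono_eval_def)

lemma mono_eval_add: "mono_eval x (m + m') = mono_eval x m * mono_eval x m'"
proof -
  let ?V = "Poly_Mapping.keys m \<union> Poly_Mapping.keys m'"
  have "Poly_Mapping.keys (m + m') \<subseteq> ?V"
    by (rule keys_add)
  then show ?thesis
    by (simp add: mono_eval_superset[of ?V] lookup_add power_add prod.distrib)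
qed

lemma mono_deriv_0 [simp]: "mono_deriv x j 0 = 0"
  by (simp add: mono_deriv_def)

lemma mono_deriv_single_1: "mono_deriv x j (Poly_Mapping.single k 1) = (if j = k then 1 else 0)"
  by (simp add: mono_deriv_def lookup_single)

lemma mono_deriv_add:
  "mono_deriv x j (m + m') = mono_eval x m * mono_deriv x j m' + mono_eval x m' * mono_deriv x j m"
proof -
  let ?e = "Poly_Mapping.single j 1 :: nat \<Rightarrow>\<^sub>0 nat"
  \<comment> \<open>Truncated subtraction of the exponent is harmless, as the coefficient then vanishes.\<close>
  have shift: "of_nat (Poly_Mapping.lookup a j) * mono_eval x (a + b - ?e)
      = of_nat (Poly_Mapping.lookup a j) * mono_eval x (a - ?e) * mono_eval x b" for a b :: "nat \<Rightarrow>\<^sub>0 nat"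
  proof (cases "Poly_Mapping.lookup a j = 0")
    case False
    then have "a + b - ?e = (a - ?e) + b"
      by (intro poly_mapping_eqI) (auto simp: lookup_add lookup_minus lookup_single when_def)
    then show ?thesis
      by (simp add: mono_eval_add mult.assoc)
  qed simp
  show ?thesis
    unfolding mono_deriv_def
    using shift[of m m'] shift[of m' m]
    by (simp add: lookup_add distrib_right add.commute[of m' m] mult_ac)
qed

lemma cpoly_eval_superset:
  assumes "finite V" "Poly_Mapping.keys f \<subseteq> V"
  shows "cpoly_eval x f = (\<Sum>m\<in>V. of_cx (Poly_Mapping.lookup f m) * mono_eval x m)"
  unfolding cpoly_eval_def mono_eval_def
  by (rule sum.mono_neutral_left[OF assms]) (simp add: not_in_keys_iff_lookup_eq_zero)

lemma cpoly_eval_0 [simp]: "cpoly_eval x 0 = 0"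
  by (simp add: cpoly_eval_def)

lemma cpoly_eval_single [simp]: "cpoly_eval x (Poly_Mapping.single m c) = of_cx c * mono_eval x m"
  by (cases "c = 0") (simp_all add: cpoly_eval_def mono_eval_def)

lemma cpoly_eval_add [simp]: "cpoly_eval x (f + g) = cpoly_eval x f + cpoly_eval x g"
proof -
  let ?V = "Poly_Mapping.keys f \<union> Poly_Mapping.keys g"
  have "Poly_Mapping.keys (f + g) \<subseteq> ?V"
    by (rule keys_add)
  then show ?thesis
    by (simp add: cpoly_eval_superset[of ?V] lookup_add of_cx_add distrib_right sum.distrib)
qed

lemma cpoly_eval_sum [simp]: "cpoly_eval x (sum f K) = (\<Sum>k\<in>K. cpoly_eval x (f k))"
  by (induction K rule: infinite_finite_induct) simp_all

lemma cpoly_eval_diff [simp]: "cpoly_eval x (f - g) = cpoly_eval x f - cpoly_eval x g"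
  using cpoly_eval_add[of x "f - g" g] by (simp add: algebra_simps)

lemma cpoly_eval_mult [simp]: "cpoly_eval x (f * g) = cpoly_eval x f * cpoly_eval x g"
proof (induction f rule: poly_mapping_add_induct)
  case (3 m c)
  show ?case
    by (induction g rule: poly_mapping_add_induct)
      (simp_all add: mult_single of_cx_mult mono_eval_add algebra_simps)
qed (simp_all add: algebra_simps)

lemma of_cx_of_nat: "of_cx (of_nat k) = (of_nat k :: 'r::complex_alg)"
  by (induction k) (simp_all add: of_cx_add of_cx_1)

lemma eval_pderiv_superset:
  assumes "finite V" "Poly_Mapping.keys f \<subseteq> V"
  shows "eval_pderiv x j f = (\<Sum>m\<in>V. of_cx (Poly_Mapping.lookup f m) * mono_deriv x j m)"
proof -
  have "eval_pderiv x j f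
      = (\<Sum>m\<in>Poly_Mapping.keys f. of_cx (Poly_Mapping.lookup f m) * mono_deriv x j m)"
    by (simp add: cpoly_pderiv_def mono_deriv_def of_cx_mult of_cx_of_nat mult_ac)
  also have "\<dots> = (\<Sum>m\<in>V. of_cx (Poly_Mapping.lookup f m) * mono_deriv x j m)"
    by (rule sum.mono_neutral_left[OF assms]) (simp add: not_in_keys_iff_lookup_eq_zero)
  finally show ?thesis .
qed

lemma eval_pderiv_0 [simp]: "eval_pderiv x j 0 = 0"
  by (simp add: cpoly_pderiv_def)

lemma eval_pderiv_single [simp]:
  "eval_pderiv x j (Poly_Mapping.single m c) = of_cx c * mono_deriv x j m"
  by (cases "c = 0") (simp_all add: eval_pderiv_superset[of "{m}"])

lemma eval_pderiv_add [simp]: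
  "eval_pderiv x j (f + g) = eval_pderiv x j f + eval_pderiv x j g"
proof -
  let ?V = "Poly_Mapping.keys f \<union> Poly_Mapping.keys g"
  have "Poly_Mapping.keys (f + g) \<subseteq> ?V"
    by (rule keys_add)
  then show ?thesis
    by (simp add: eval_pderiv_superset[of ?V] lookup_add of_cx_add distrib_right sum.distrib)
qed

lemma eval_pderiv_mult [simp]:
  "eval_pderiv x j (f * g)
     = cpoly_eval x f * eval_pderiv x j g + cpoly_eval x g * eval_pderiv x j f"
proof (induction f rule: poly_mapping_add_induct)
  case (3 m c)
  show ?case
    by (induction g rule: poly_mapping_add_induct)
      (simp_all add: mult_single of_cx_mult mono_deriv_add algebra_simps)
qed (simp_all add: algebra_simps)

lemma single_0_in_cpolys: "Poly_Mapping.single 0 c \<in> cpolys n"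
  by (simp add: cpolys_def)

lemma add_in_cpolys: "f \<in> cpolys n \<Longrightarrow> g \<in> cpolys n \<Longrightarrow> f + g \<in> cpolys n"
  using keys_add[of f g] unfolding cpolys_def by blast

lemma diff_in_cpolys: "f \<in> cpolys n \<Longrightarrow> g \<in> cpolys n \<Longrightarrow> f - g \<in> cpolys n"
  using keys_diff[of f g] unfolding cpolys_def by blast

lemma mult_in_cpolys:
  assumes "f \<in> cpolys n" "g \<in> cpolys n"
  shows "f * g \<in> cpolys n"
proof -
  have "Poly_Mapping.keys m \<subseteq> {..<n}" if m: "m \<in> Poly_Mapping.keys (f * g)" for m
  proof -
    obtain a b where "m = a + b" "a \<in> Poly_Mapping.keys f" "b \<in> Poly_Mapping.keys g"
      using m keys_mult[of f g] by blast
    then show ?thesis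
      using assms keys_add[of a b] unfolding cpolys_def by blast
  qed
  then show ?thesis
    by (simp add: cpolys_def)
qed

lemma derivation_mono_eval:
  fixes \<delta> :: "'b::complex_alg \<Rightarrow> 'b"
  assumes \<delta>: "derivation (*) \<delta>" and m: "Poly_Mapping.keys m \<subseteq> {..<n}"
  shows "\<delta> (mono_eval x m) = (\<Sum>j<n. mono_deriv x j m * \<delta> (x j))"
proof -
  let ?Q = "\<lambda>m. \<delta> (mono_eval x m) = (\<Sum>j<n. mono_deriv x j m * \<delta> (x j))"
  have zero: "?Q 0"
    by (simp add: derivation_1[OF \<delta>])
  have add: "?Q (a + b)" if "?Q a" "?Q b" for a b
    by (simp add: mono_eval_add mono_deriv_add derivation_mult[OF \<delta>] that sum_distrib_left
        distrib_right sum.distrib mult.assoc)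
  have var: "?Q (Poly_Mapping.single j 1)" if "j < n" for j
    unfolding mono_deriv_single_1 mono_eval_single_1
    using that by (simp add: if_distrib[of "\<lambda>c. c * _"] cong: if_cong)
  have power: "?Q (Poly_Mapping.single j k)" if "j < n" for j k
  proof (induction k)
    case (Suc k)
    have "Poly_Mapping.single j (Suc k) = Poly_Mapping.single j k + Poly_Mapping.single j 1"
      by (simp add: single_add[symmetric])
    then show ?case
      using add[OF Suc var[OF that]] by simp
  qed (simp add: derivation_1[OF \<delta>])
  have "?Q (\<Sum>i\<in>K. Poly_Mapping.single i (Poly_Mapping.lookup m i))"
    if "K \<subseteq> Poly_Mapping.keys m" for K
    using that
  proof (induction K rule: infinite_finite_induct)
    case (insert i K)
    then have "i < n" using m by auto
    then show ?case
      using add[OF power insert.IH] insert by simp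
  qed (simp_all add: derivation_1[OF \<delta>])
  from this[of "Poly_Mapping.keys m"] show ?thesis
    by (simp add: poly_mapping_sum_single)
qed

text \<open>The chain rule. Applied to an equation \<open>f\<close> with \<open>f(x) = 0\<close> it says that the rows of the
  Jacobian matrix annihilate the vector \<open>(\<delta> (x j))\<^sub>j\<close>, which is how the equations of a variety constrain
  its derivations.\<close>

lemma derivation_cpoly_eval:
  fixes \<delta> :: "'b::complex_alg \<Rightarrow> 'b"
  assumes \<delta>: "derivation (*) \<delta>" and f: "f \<in> cpolys n"
  shows "\<delta> (cpoly_eval x f) = (\<Sum>j<n. eval_pderiv x j f * \<delta> (x j))"
proof -
  let ?K = "Poly_Mapping.keys f"
  have "\<delta> (cpoly_eval x f)
      = (\<Sum>m\<in>?K. of_cx (Poly_Mapping.lookup f m) * \<delta> (mono_eval x m))"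
    by (simp add: cpoly_eval_superset[of ?K] derivation_sum[OF \<delta>] derivation_mult[OF \<delta>]
        derivation_of_cx[OF \<delta>])
  also have "\<dots> = (\<Sum>m\<in>?K. of_cx (Poly_Mapping.lookup f m)
      * (\<Sum>j<n. mono_deriv x j m * \<delta> (x j)))"
  proof (rule sum.cong[OF refl])
    fix m assume "m \<in> ?K"
    then have "Poly_Mapping.keys m \<subseteq> {..<n}" using f by (simp add: cpolys_def)
    then show "of_cx (Poly_Mapping.lookup f m) * \<delta> (mono_eval x m)
        = of_cx (Poly_Mapping.lookup f m) * (\<Sum>j<n. mono_deriv x j m * \<delta> (x j))"
      by (simp add: derivation_mono_eval[OF \<delta>])
  qed
  also have "\<dots> = (\<Sum>j<n. eval_pderiv x j f * \<delta> (x j))"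
    unfolding sum_distrib_left
    by (subst sum.swap) (simp add: eval_pderiv_superset[of ?K] sum_distrib_right mult.assoc)
  finally show ?thesis .
qed

section \<open>Ideals and prime ideals\<close>

lemma ideal_iff:
  "module.subspace (*) J \<longleftrightarrow> 0 \<in> J \<and> (\<forall>x\<in>J. \<forall>y\<in>J. x + y \<in> J) \<and> (\<forall>r. \<forall>x\<in>J. r * x \<in> J)"
  for J :: "'r::comm_ring_1 set"
  by (rule module.subspace_def[OF module_mult])

text \<open>An ideal that is maximal among those avoiding \<open>1\<close> is prime: if \<open>x \<notin> M\<close>, then \<open>1 = m + r x\<close> with
  \<open>m \<in> M\<close>, and multiplying by \<open>y\<close> puts \<open>y\<close> into \<open>M\<close> as soon as \<open>x y\<close> is there.\<close>

lemma prime_ideal_above: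
  fixes J :: "'r::comm_ring_1 set"
  assumes J: "module.subspace (*) J" and "1 \<notin> J"
  shows "\<exists>p. prime_ideal p \<and> J \<subseteq> p"
proof -
  define \<K> where "\<K> = {K. module.subspace (*) K \<and> J \<subseteq> K \<and> 1 \<notin> K}"
  have "\<Union>\<C> \<in> \<K>" if ne: "\<C> \<noteq> {}" and chain: "subset.chain \<K> \<C>" for \<C>
  proof -
    have sub: "\<C> \<subseteq> \<K>" using chain by (simp add: subset.chain_def)
    have "x + y \<in> \<Union>\<C>" if "x \<in> \<Union>\<C>" "y \<in> \<Union>\<C>" for x y
    proof -
      obtain K K' where "K \<in> \<C>" "x \<in> K" "K' \<in> \<C>" "y \<in> K'" using \<open>x \<in> \<Union>\<C>\<close> \<open>y \<in> \<Union>\<C>\<close> by blast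
      moreover have "K \<subseteq> K' \<or> K' \<subseteq> K"
        using chain \<open>K \<in> \<C>\<close> \<open>K' \<in> \<C>\<close> unfolding subset.chain_def by blast
      ultimately obtain M where "M \<in> \<C>" "x \<in> M" "y \<in> M" by blast
      then have "x + y \<in> M" using sub unfolding \<K>_def ideal_iff by blast
      then show ?thesis using \<open>M \<in> \<C>\<close> by blast
    qed
    moreover have "0 \<in> \<Union>\<C>"
    proof -
      obtain K where "K \<in> \<C>" using ne by blast
      moreover from this have "0 \<in> K" using sub unfolding \<K>_def ideal_iff by blast
      ultimately show ?thesis by blast
    qed
    moreover have "r * x \<in> \<Union>\<C>" if x: "x \<in> \<Union>\<C>" for r x
    proof -
      obtain K where K: "K \<in> \<C>" "x \<in> K" using x by blast
      then have "r * x \<in> K" using sub unfolding \<K>_def ideal_iff by blast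
      then show ?thesis using K(1) by blast
    qed
    ultimately have "module.subspace (*) (\<Union>\<C>)" by (simp add: ideal_iff)
    then show ?thesis using ne sub unfolding \<K>_def by blast
  qed
  moreover have "\<K> \<noteq> {}" using assms by (auto simp: \<K>_def)
  ultimately obtain M where M: "M \<in> \<K>" and max: "\<And>K. K \<in> \<K> \<Longrightarrow> M \<subseteq> K \<Longrightarrow> K = M"
    using subset_Zorn_nonempty[of \<K>] by blast
  have id: "0 \<in> M" "\<And>x y. x \<in> M \<Longrightarrow> y \<in> M \<Longrightarrow> x + y \<in> M" "\<And>r x. x \<in> M \<Longrightarrow> r * x \<in> M"
    using M by (auto simp: \<K>_def ideal_iff)
  have "x \<in> M \<or> y \<in> M" if xy: "x * y \<in> M" for x y
  proof (rule ccontr)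
    assume no: "\<not> (x \<in> M \<or> y \<in> M)"
    let ?K = "{m + r * x | m r. m \<in> M}"
    have "module.subspace (*) ?K"
      unfolding ideal_iff
    proof (intro conjI ballI allI)
      show "0 \<in> ?K" using id(1) by (intro CollectI exI[of _ 0]) simp
    next
      fix u v assume "u \<in> ?K" "v \<in> ?K"
      then obtain m r m' r' where "u = m + r * x" "v = m' + r' * x" "m \<in> M" "m' \<in> M" by blast
      then show "u + v \<in> ?K"
        by (intro CollectI exI[of _ "m + m'"] exI[of _ "r + r'"]) (simp add: id algebra_simps)
    next
      fix s u assume "u \<in> ?K"
      then obtain m r where "u = m + r * x" "m \<in> M" by blast
      then show "s * u \<in> ?K"
        by (intro CollectI exI[of _ "s * m"] exI[of _ "s * r"]) (simp add: id distrib_left mult.assoc)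
    qed
    moreover have "M \<subseteq> ?K"
    proof
      fix m assume "m \<in> M"
      then show "m \<in> ?K" by (intro CollectI exI[of _ m] exI[of _ 0]) simp
    qed
    moreover have "x \<in> ?K" using id(1) by (intro CollectI exI[of _ 0] exI[of _ 1]) simp
    ultimately have "1 \<in> ?K"
      using max[of ?K] M no unfolding \<K>_def by blast
    then obtain m r where one: "1 = m + r * x" and "m \<in> M" by blast
    have "y = y * (m + r * x)" by (simp add: one[symmetric])
    then have "y = y * m + r * (x * y)" by (simp only: distrib_left mult_ac)
    then have "y \<in> M" using id(2)[OF id(3)[OF \<open>m \<in> M\<close>, of y] id(3)[OF xy, of r]] by metis
    then show False using no by blast
  qed
  then show ?thesis using M by (auto simp: prime_ideal_def \<K>_def)
qed

text \<open>This is the only way in which local hypotheses become global. Typically \<open>J\<close> consists of those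
  \<open>r\<close> for which a construction exists after multiplication by \<open>r\<close>; that such \<open>r\<close> form an ideal is the
  gluing by a partition of unity.\<close>

lemma ideal_local_global:
  fixes J :: "'r::comm_ring_1 set"
  assumes "module.subspace (*) J" and "\<And>p. prime_ideal p \<Longrightarrow> \<exists>f\<in>J. f \<notin> p"
  shows "1 \<in> J"
  using prime_ideal_above[of J] assms by blast

lemma prime_ideal_power: "prime_ideal p \<Longrightarrow> f ^ k \<in> p \<Longrightarrow> f \<in> p"
  by (induction k) (auto simp: prime_ideal_def)

text \<open>A prime containing the powers contains the elements themselves. Hence denominators coming from a
  cover by the loci \<open>f \<noteq> 0\<close> may be raised to any exponent.\<close>

lemma unit_ideal_powers:
  fixes F :: "'r::comm_ring_1 set"
  assumes "1 \<in> module.span (*) F"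
  shows "1 \<in> module.span (*) ((\<lambda>f. f ^ k f) ` F)"
proof (rule ideal_local_global)
  interpret M: module "(*) :: 'r \<Rightarrow> 'r \<Rightarrow> 'r" by (rule module_mult)
  show "M.subspace (M.span ((\<lambda>f. f ^ k f) ` F))" by (rule M.subspace_span)
  fix p :: "'r set" assume p: "prime_ideal p"
  show "\<exists>f\<in>M.span ((\<lambda>f. f ^ k f) ` F). f \<notin> p"
  proof (rule ccontr)
    assume no: "\<not> ?thesis"
    have "F \<subseteq> p"
    proof
      fix f assume "f \<in> F"
      then have "f ^ k f \<in> M.span ((\<lambda>f. f ^ k f) ` F)" by (intro M.span_base imageI)
      then show "f \<in> p" using no prime_ideal_power[OF p] by blast
    qed
    moreover have "M.subspace p" using p by (simp add: prime_ideal_def)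
    ultimately have "M.span F \<subseteq> p" by (rule M.span_minimal)
    then show False using assms p by (auto simp: prime_ideal_def)
  qed
qed

lemma unit_ideal_eq_one:
  fixes g :: "'i \<Rightarrow> 'r::comm_ring_1"
  assumes "finite F" and "1 \<in> module.span (*) (g ` F)"
  shows "\<exists>u. (\<Sum>f\<in>F. u f * g f) = 1"
proof -
  interpret M: module "(*) :: 'r \<Rightarrow> 'r \<Rightarrow> 'r" by (rule module_mult)
  define S where "S = {x. \<exists>u. x = (\<Sum>f\<in>F. u f * g f)}"
  have "M.subspace S"
    unfolding ideal_iff
  proof (intro conjI ballI allI)
    show "0 \<in> S" unfolding S_def by (intro CollectI exI[of _ "\<lambda>_. 0"]) simp
  next
    fix x y assume "x \<in> S" "y \<in> S"
    then obtain u v where "x = (\<Sum>f\<in>F. u f * g f)" "y = (\<Sum>f\<in>F. v f * g f)"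
      by (auto simp: S_def)
    then show "x + y \<in> S"
      unfolding S_def
      by (intro CollectI exI[of _ "\<lambda>f. u f + v f"]) (simp add: distrib_right sum.distrib)
  next
    fix r x assume "x \<in> S"
    then obtain u where "x = (\<Sum>f\<in>F. u f * g f)" by (auto simp: S_def)
    then have "r * x = (\<Sum>f\<in>F. (r * u f) * g f)"
      by (simp only: sum_distrib_left mult.assoc)
    then show "r * x \<in> S"
      unfolding S_def by (intro CollectI exI[of _ "\<lambda>f. r * u f"])
  qed
  moreover have "g ` F \<subseteq> S"
  proof
    fix x assume "x \<in> g ` F"
    then obtain f where f: "f \<in> F" "x = g f" by blast
    have "(\<Sum>h\<in>F. (if h = f then 1 else 0) * g h) = (\<Sum>h\<in>F. if h = f then g h else 0)"
      by (rule sum.cong) auto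
    then have "x = (\<Sum>h\<in>F. (if h = f then 1 else 0) * g h)"
      using f \<open>finite F\<close> by simp
    then show "x \<in> S"
      unfolding S_def by (intro CollectI exI[of _ "\<lambda>h. if h = f then 1 else 0"])
  qed
  ultimately have "M.span (g ` F) \<subseteq> S"
    by (intro M.span_minimal)
  then have "1 \<in> S" using assms(2) by blast
  then obtain u where "1 = (\<Sum>f\<in>F. u f * g f)" by (auto simp: S_def)
  then show ?thesis by (intro exI[of _ u]) (rule sym)
qed

section \<open>Differentials of a smooth affine variety\<close>

text \<open>Modulo \<open>p\<close> this is the existence of a right inverse, up to the factor \<open>\<Delta>\<close>, of a matrix with
  independent rows. The equations are required to hold exactly and not just modulo \<open>p\<close>, so that they
  survive on the neighbourhood \<open>\<Delta> \<noteq> 0\<close>. They come from a fraction-free form of Gram-Schmidt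
  orthogonalisation, one row at a time.\<close>

lemma independent_rows_dual_vectors:
  fixes M :: "nat \<Rightarrow> nat \<Rightarrow> 'b::comm_ring_1"
  assumes p: "prime_ideal p"
    and indep: "\<forall>r :: nat \<Rightarrow> 'b. (\<forall>j<n. (\<Sum>i<c. r i * M i j) \<in> p) \<longrightarrow> (\<forall>i<c. r i \<in> p)"
  shows "\<exists>\<Delta> v. \<Delta> \<notin> p \<and> (\<forall>i<c. \<forall>k<c. (\<Sum>j<n. M i j * v k j) = (if i = k then \<Delta> else 0))"
  using indep
proof (induction c)
  case 0
  then show ?case using p by (intro exI[of _ 1]) (simp add: prime_ideal_def)
next
  case (Suc c)
  have prod: "x * y \<notin> p" if "x \<notin> p" "y \<notin> p" for x y
    using p that by (auto simp: prime_ideal_def)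
  have zero: "0 \<in> p" using p by (simp add: prime_ideal_def ideal_iff)
  have "\<forall>r :: nat \<Rightarrow> 'b. (\<forall>j<n. (\<Sum>i<c. r i * M i j) \<in> p) \<longrightarrow> (\<forall>i<c. r i \<in> p)"
  proof (intro allI impI)
    fix r :: "nat \<Rightarrow> 'b" and i
    assume r: "\<forall>j<n. (\<Sum>i<c. r i * M i j) \<in> p" and "i < c"
    have "\<forall>j<n. (\<Sum>i<Suc c. (if i < c then r i else 0) * M i j) \<in> p"
      using r by simp
    from Suc.prems[rule_format, OF this[rule_format], of i] show "r i \<in> p"
      using \<open>i < c\<close> by simp
  qed
  from Suc.IH[OF this] obtain \<Delta> v where \<Delta>: "\<Delta> \<notin> p"
    and dual: "\<And>i k. i < c \<Longrightarrow> k < c \<Longrightarrow> (\<Sum>j<n. M i j * v k j) = (if i = k then \<Delta> else 0)"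
    by blast
  define a where "a k = (\<Sum>j<n. M c j * v k j)" for k
  define row where "row j = \<Delta> * M c j - (\<Sum>k<c. a k * M k j)" for j
  \<comment> \<open>\<open>row\<close> is the new row made orthogonal to the dual vectors \<open>v\<close>; it is a combination of the rows in
    which the new one has the coefficient \<open>\<Delta> \<notin> p\<close>, so independence keeps it nonzero modulo \<open>p\<close>.\<close>
  have "\<exists>j<n. row j \<notin> p"
  proof (rule ccontr)
    assume "\<not> ?thesis"
    moreover have "(\<Sum>i<Suc c. (if i < c then - a i else \<Delta>) * M i j) = row j" for j
      by (simp add: row_def sum_negf)
    ultimately have "\<forall>j<n. (\<Sum>i<Suc c. (if i < c then - a i else \<Delta>) * M i j) \<in> p"
      by simp
    from Suc.prems[rule_format, OF this[rule_format], of c] \<Delta> show False by simp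
  qed
  then obtain j0 where j0: "j0 < n" "row j0 \<notin> p" by blast
  \<comment> \<open>Dually, \<open>w\<close> is a basis vector made orthogonal to the old rows; it pairs with the new row to
    \<open>row j0\<close>.\<close>
  define w where "w j = (if j = j0 then \<Delta> else 0) - (\<Sum>k<c. M k j0 * v k j)" for j
  have pair_w: "(\<Sum>j<n. M i j * w j) = M i j0 * \<Delta> - (\<Sum>k<c. M k j0 * (\<Sum>j<n. M i j * v k j))" for i
  proof -
    have "(\<Sum>j<n. M i j * (if j = j0 then \<Delta> else 0)) = (\<Sum>j<n. if j = j0 then M i j * \<Delta> else 0)"
      by (rule sum.cong) auto
    also have "\<dots> = M i j0 * \<Delta>" using j0(1) by simp
    finally have "(\<Sum>j<n. M i j * w j) = M i j0 * \<Delta> - (\<Sum>j<n. \<Sum>k<c. M i j * (M k j0 * v k j))"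
      by (simp add: w_def right_diff_distrib sum_subtractf sum_distrib_left)
    also have "(\<Sum>j<n. \<Sum>k<c. M i j * (M k j0 * v k j)) = (\<Sum>k<c. M k j0 * (\<Sum>j<n. M i j * v k j))"
      by (subst sum.swap) (simp add: sum_distrib_left mult_ac)
    finally show ?thesis .
  qed
  have old_w: "(\<Sum>j<n. M i j * w j) = 0" if "i < c" for i
  proof -
    have "(\<Sum>k<c. M k j0 * (\<Sum>j<n. M i j * v k j)) = (\<Sum>k<c. if k = i then M k j0 * \<Delta> else 0)"
      using that by (intro sum.cong) (auto simp: dual)
    then show ?thesis using that by (simp add: pair_w)
  qed
  have new_w: "(\<Sum>j<n. M c j * w j) = row j0"
    unfolding pair_w row_def a_def by (simp add: mult.commute)
  define v' where "v' k j = (if k < c then row j0 * v k j - a k * w j else \<Delta> * w j)" for k j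
  have pair_v': "(\<Sum>j<n. M i j * v' k j) = (if k < c
      then row j0 * (\<Sum>j<n. M i j * v k j) - a k * (\<Sum>j<n. M i j * w j)
      else \<Delta> * (\<Sum>j<n. M i j * w j))" for i k
    by (simp add: v'_def right_diff_distrib sum_subtractf sum_distrib_left mult_ac)
  have "(\<Sum>j<n. M i j * v' k j) = (if i = k then row j0 * \<Delta> else 0)"
    if "i < Suc c" "k < Suc c" for i k
    using that unfolding pair_v'
    by (cases "i = c"; cases "k = c") (simp_all add: old_w new_w dual a_def[symmetric])
  then show ?case using prod[OF j0(2) \<Delta>] by blast
qed

text \<open>In terms of the differentials: the elements \<open>d (x j)\<close> with the coordinates given by \<open>\<theta> j\<close> form a
  dual basis, so that the module of differentials is projective. Near a prime \<open>p\<close> the variety is cut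
  out by equations \<open>g i\<close> with independent differentials. The coordinate vector fields of affine space,
  multiplied by \<open>\<Delta>\<close> and corrected along the dual vectors of the Jacobian matrix, kill all \<open>g i\<close>;
  after multiplication by \<open>s\<close>, which clears the difference between the ideal of the variety and the
  one generated by the \<open>g i\<close>, they act on the coordinate ring. This proves the claim up to the factor
  \<open>s \<Delta> \<notin> p\<close>, and such factors form an ideal.\<close>

lemma smooth_affine_dual_basis:
  assumes "smooth_affine TYPE('b::complex_alg)"
  shows "\<exists>n. \<exists>x :: nat \<Rightarrow> 'b. \<exists>\<theta> :: nat \<Rightarrow> 'b \<Rightarrow> 'b.
    (\<forall>j. derivation (*) (\<theta> j)) \<and>
    (\<forall>\<delta> b. derivation (*) \<delta> \<longrightarrow> \<delta> b = (\<Sum>j<n. \<theta> j b * \<delta> (x j)))"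
proof -
  from assms obtain n and x :: "nat \<Rightarrow> 'b" where
    gen: "cpoly_eval x ` cpolys n = UNIV" and
    jac: "\<And>p :: 'b set. prime_ideal p \<Longrightarrow>
          (\<exists>c. \<exists>g :: nat \<Rightarrow> cpoly. \<exists>s \<in> cpolys n.
             (\<forall>i<c. g i \<in> cpolys n \<and> cpoly_eval x (g i) = 0) \<and>
             cpoly_eval x s \<notin> p \<and>
             (\<forall>h \<in> cpolys n. cpoly_eval x h = 0 \<longrightarrow>
                (\<exists>q. (\<forall>i<c. q i \<in> cpolys n) \<and> s * h = (\<Sum>i<c. q i * g i))) \<and>
             (\<forall>r :: nat \<Rightarrow> 'b.
                (\<forall>j<n. (\<Sum>i<c. r i * eval_pderiv x j (g i)) \<in> p) \<longrightarrow>
                (\<forall>i<c. r i \<in> p)))"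
    unfolding smooth_affine_def by blast
  define J where "J = {t. \<exists>\<theta>. (\<forall>j. derivation (*) (\<theta> j)) \<and>
    (\<forall>\<delta> b. derivation (*) \<delta> \<longrightarrow> t * \<delta> b = (\<Sum>j<n. \<theta> j b * \<delta> (x j)))}"
  have "1 \<in> J"
  proof (rule ideal_local_global)
    show "module.subspace (*) J"
      unfolding ideal_iff
    proof (intro conjI ballI allI)
      show "0 \<in> J"
        unfolding J_def by (intro CollectI exI[of _ "\<lambda>_ _. 0"]) (simp add: derivation_def)
    next
      fix t t' assume "t \<in> J" "t' \<in> J"
      then obtain \<theta> \<theta>' where "\<forall>j. derivation (*) (\<theta> j)" "\<forall>j. derivation (*) (\<theta>' j)"
        and "\<forall>\<delta> b. derivation (*) \<delta> \<longrightarrow> t * \<delta> b = (\<Sum>j<n. \<theta> j b * \<delta> (x j))"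
        and "\<forall>\<delta> b. derivation (*) \<delta> \<longrightarrow> t' * \<delta> b = (\<Sum>j<n. \<theta>' j b * \<delta> (x j))"
        unfolding J_def by blast
      then show "t + t' \<in> J"
        unfolding J_def
        by (intro CollectI exI[of _ "\<lambda>j b. \<theta> j b + \<theta>' j b"])
          (simp add: derivation_def distrib_right distrib_left sum.distrib add_ac)
    next
      fix r t assume "t \<in> J"
      then obtain \<theta> where "\<forall>j. derivation (*) (\<theta> j)"
        and "\<forall>\<delta> b. derivation (*) \<delta> \<longrightarrow> t * \<delta> b = (\<Sum>j<n. \<theta> j b * \<delta> (x j))"
        unfolding J_def by blast
      then show "r * t \<in> J"
        unfolding J_def
        by (intro CollectI exI[of _ "\<lambda>j b. r * \<theta> j b"])
          (simp add: derivation_def distrib_left mult_ac sum_distrib_left)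
    qed
  next
    fix p :: "'b set" assume p: "prime_ideal p"
    obtain c g s where s: "s \<in> cpolys n" and
      loc: "(\<forall>i<c. g i \<in> cpolys n \<and> cpoly_eval x (g i) = 0) \<and>
             cpoly_eval x s \<notin> p \<and>
             (\<forall>h \<in> cpolys n. cpoly_eval x h = 0 \<longrightarrow>
                (\<exists>q. (\<forall>i<c. q i \<in> cpolys n) \<and> s * h = (\<Sum>i<c. q i * g i))) \<and>
             (\<forall>r :: nat \<Rightarrow> 'b.
                (\<forall>j<n. (\<Sum>i<c. r i * eval_pderiv x j (g i)) \<in> p) \<longrightarrow>
                (\<forall>i<c. r i \<in> p))"
      using jac[OF p] by (elim exE bexE) (rule that)
    have s_p: "cpoly_eval x s \<notin> p" using loc by (elim conjE)
    have g: "g i \<in> cpolys n" "cpoly_eval x (g i) = 0" if "i < c" for i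
      using conjunct1[OF loc] that by simp_all
    have rel: "\<exists>q. s * h = (\<Sum>i<c. q i * g i)" if "h \<in> cpolys n" "cpoly_eval x h = 0" for h
    proof -
      have "\<forall>h \<in> cpolys n. cpoly_eval x h = 0 \<longrightarrow>
                (\<exists>q. (\<forall>i<c. q i \<in> cpolys n) \<and> s * h = (\<Sum>i<c. q i * g i))"
        using loc by (elim conjE)
      then show ?thesis using that by auto
    qed
    have indep: "\<forall>r :: nat \<Rightarrow> 'b. (\<forall>j<n. (\<Sum>i<c. r i * eval_pderiv x j (g i)) \<in> p) \<longrightarrow>
                (\<forall>i<c. r i \<in> p)"
      using loc by (elim conjE)
    obtain \<Delta> v where "\<Delta> \<notin> p \<and> (\<forall>i<c. \<forall>k<c.
        (\<Sum>j<n. eval_pderiv x j (g i) * v k j) = (if i = k then \<Delta> else 0))"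
      using independent_rows_dual_vectors[where n = n and c = c and M = "\<lambda>i j. eval_pderiv x j (g i)",
          OF p indep]
      by (elim exE) (rule that)
    then have \<Delta>: "\<Delta> \<notin> p" and dual: "\<And>i k. i < c \<Longrightarrow> k < c \<Longrightarrow>
        (\<Sum>j<n. eval_pderiv x j (g i) * v k j) = (if i = k then \<Delta> else 0)"
      by simp_all
    let ?s = "cpoly_eval x s"
    \<comment> \<open>\<open>E j\<close> is the corrected coordinate vector field, followed by restriction to the variety.\<close>
    define E where "E j f = \<Delta> * eval_pderiv x j f
        - (\<Sum>k<c. eval_pderiv x j (g k) * (\<Sum>i<n. eval_pderiv x i f * v k i))" for j f
    have E_add: "E j (f + h) = E j f + E j h" for j f h
      by (simp add: E_def algebra_simps sum.distrib sum_distrib_left)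
    have E_diff: "E j (f - h) = E j f - E j h" for j f h
      using E_add[of j "f - h" h] by simp
    have E_0: "E j 0 = 0" for j
      by (simp add: E_def)
    have E_sum: "E j (sum q K) = (\<Sum>k\<in>K. E j (q k))" for j K and q :: "nat \<Rightarrow> cpoly"
      by (induction K rule: infinite_finite_induct) (simp_all add: E_0 E_add)
    have E_mult: "E j (f * h) = cpoly_eval x f * E j h + cpoly_eval x h * E j f" for j f h
      by (simp add: E_def algebra_simps sum.distrib sum_distrib_left)
    have E_g: "E j (g i) = 0" if "i < c" for i j
    proof -
      have "(\<Sum>k<c. eval_pderiv x j (g k) * (\<Sum>l<n. eval_pderiv x l (g i) * v k l))
          = (\<Sum>k<c. if k = i then eval_pderiv x j (g k) * \<Delta> else 0)"
        using that by (intro sum.cong) (auto simp: dual)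
      then show ?thesis using that by (simp add: E_def mult.commute)
    qed
    have sE: "?s * E j h = 0" if h: "h \<in> cpolys n" "cpoly_eval x h = 0" for j h
    proof -
      obtain q where q: "s * h = (\<Sum>i<c. q i * g i)" using rel[OF h] by blast
      \<comment> \<open>The term with \<open>E j s\<close> drops out, as \<open>h\<close> vanishes on the variety.\<close>
      have "?s * E j h = E j (s * h)" by (simp add: E_mult h)
      also have "\<dots> = 0" by (simp add: q E_sum E_mult E_g g)
      finally show ?thesis .
    qed
    define lift where "lift b = (SOME f. f \<in> cpolys n \<and> cpoly_eval x f = b)" for b
    have lift: "lift b \<in> cpolys n" "cpoly_eval x (lift b) = b" for b
    proof -
      have "\<exists>f. f \<in> cpolys n \<and> cpoly_eval x f = b" using gen by (metis UNIV_I imageE)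
      then show "lift b \<in> cpolys n" "cpoly_eval x (lift b) = b"
        unfolding lift_def by (metis (mono_tags, lifting) someI_ex)+
    qed
    define \<theta> where "\<theta> j b = ?s * E j (lift b)" for j b
    have \<theta>: "\<theta> j (cpoly_eval x f) = ?s * E j f" if "f \<in> cpolys n" for j f
      using sE[of "lift (cpoly_eval x f) - f" j] that
      by (simp add: \<theta>_def lift diff_in_cpolys E_diff right_diff_distrib)
    have "derivation (*) (\<theta> j)" for j
    proof (rule derivationI)
      fix a b
      show "\<theta> j (a + b) = \<theta> j a + \<theta> j b"
        using \<theta>[OF add_in_cpolys[OF lift(1)[of a] lift(1)[of b]], of j]
        by (simp add: lift E_add distrib_left \<theta>_def)
      show "\<theta> j (a * b) = a * \<theta> j b + b * \<theta> j a"
        using \<theta>[OF mult_in_cpolys[OF lift(1)[of a] lift(1)[of b]], of j]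
        by (simp add: lift E_mult algebra_simps \<theta>_def)
    next
      fix z
      have "E j (Poly_Mapping.single 0 z) = 0" by (simp add: E_def)
      then show "\<theta> j (of_cx z) = 0"
        using \<theta>[OF single_0_in_cpolys[of z n], of j] by simp
    qed
    moreover have "?s * \<Delta> * \<delta> b = (\<Sum>j<n. \<theta> j b * \<delta> (x j))" if \<delta>: "derivation (*) \<delta>" for \<delta> b
    proof -
      define f where "f = lift b"
      have f: "f \<in> cpolys n" "cpoly_eval x f = b" by (simp_all add: f_def lift)
      have "(\<Sum>j<n. eval_pderiv x j (g k) * \<delta> (x j)) = 0" if "k < c" for k
        using derivation_cpoly_eval[OF \<delta> g(1)[OF that], of x] g(2)[OF that]
        by (simp add: derivation_0[OF \<delta>])
      then have "(\<Sum>k<c. (\<Sum>i<n. eval_pderiv x i f * v k i)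
          * (\<Sum>j<n. eval_pderiv x j (g k) * \<delta> (x j))) = 0"
        by simp
      moreover have "(\<Sum>j<n. E j f * \<delta> (x j)) = \<Delta> * (\<Sum>j<n. eval_pderiv x j f * \<delta> (x j))
          - (\<Sum>k<c. (\<Sum>i<n. eval_pderiv x i f * v k i)
              * (\<Sum>j<n. eval_pderiv x j (g k) * \<delta> (x j)))"
      proof -
        have "(\<Sum>j<n. (\<Sum>k<c. eval_pderiv x j (g k) * (\<Sum>i<n. eval_pderiv x i f * v k i)) * \<delta> (x j))
          = (\<Sum>k<c. (\<Sum>i<n. eval_pderiv x i f * v k i) * (\<Sum>j<n. eval_pderiv x j (g k) * \<delta> (x j)))"
          unfolding sum_distrib_right[of _ _ "\<delta> _"]
          by (subst sum.swap) (simp add: sum_distrib_left[of "\<Sum>i<n. _ i"] mult_ac)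
        then show ?thesis
          by (simp add: E_def left_diff_distrib sum_subtractf sum_distrib_left mult.assoc)
      qed
      moreover have "\<delta> b = (\<Sum>j<n. eval_pderiv x j f * \<delta> (x j))"
        using derivation_cpoly_eval[OF \<delta> f(1), of x] f(2) by simp
      ultimately have "\<Delta> * \<delta> b = (\<Sum>j<n. E j f * \<delta> (x j))" by simp
      then show ?thesis by (simp add: \<theta>_def f_def sum_distrib_left mult.assoc)
    qed
    ultimately have "?s * \<Delta> \<in> J" unfolding J_def by blast
    moreover have "?s * \<Delta> \<notin> p" using p s_p \<Delta> by (auto simp: prime_ideal_def)
    ultimately show "\<exists>f\<in>J. f \<notin> p" by blast
  qed
  then show ?thesis unfolding J_def by auto
qed

section \<open>Modules over complex algebras\<close>

lemma complex_alg_hom_simps: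
  assumes "complex_alg_hom \<pi>"
  shows "\<pi> (x + y) = \<pi> x + \<pi> y" and "\<pi> (x * y) = \<pi> x * \<pi> y" and "\<pi> (of_cx c) = of_cx c"
    and "\<pi> 0 = 0" and "\<pi> 1 = 1"
  using assms of_cx_0 of_cx_1 unfolding complex_alg_hom_def by metis+

lemma module_restrict_scalars:
  assumes "complex_alg_hom \<pi>" and "module t"
  shows "module (\<lambda>a. t (\<pi> a))"
proof -
  interpret T: module t by (rule assms)
  show ?thesis
    by unfold_locales
      (simp_all add: complex_alg_hom_simps[OF assms(1)] T.scale_right_distrib T.scale_left_distrib)
qed

lemma module_op_scale:
  assumes "module s"
  shows "module (op_scale s)"
proof -
  interpret S: module s by (rule assms)
  show ?thesis
    by unfold_locales
      (auto simp: op_scale_def fun_eq_iff S.scale_right_distrib S.scale_left_distrib)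
qed

lemma module_of_cx:
  assumes "module s"
  shows "module (\<lambda>c. s (of_cx c))"
proof -
  interpret S: module s by (rule assms)
  show ?thesis
    by unfold_locales
      (simp_all add: S.scale_right_distrib S.scale_left_distrib of_cx_add of_cx_mult of_cx_1)
qed

lemma linear_of_cx_iff:
  assumes "module s" and "module t"
  shows "Vector_Spaces.linear (\<lambda>c. s (of_cx c)) (\<lambda>c. t (of_cx c)) D \<longleftrightarrow>
    (\<forall>x y. D (x + y) = D x + D y) \<and> (\<forall>c x. D (s (of_cx c) x) = t (of_cx c) (D x))"
  by (simp add: module_hom_iff_linear[symmetric] module_hom_iff module_of_cx assms)

section \<open>Differential operators\<close>

lemma diff_ops_linear:
  assumes "module s" "module t" "D \<in> diff_ops k s t"
  shows "D (x + y) = D x + D y" and "D (s (of_cx c) x) = t (of_cx c) (D x)"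
  using assms(3) by (cases k; simp add: linear_of_cx_iff[OF assms(1,2)])+

lemma diff_ops_zero:
  assumes "module s" "module t"
  shows "(\<lambda>_. 0) \<in> diff_ops k s t"
proof -
  interpret T: module t by (rule assms)
  show ?thesis by (induction k) (simp_all add: linear_of_cx_iff[OF assms])
qed

lemma diff_ops_add:
  assumes "module s" "module t"
  shows "D \<in> diff_ops k s t \<Longrightarrow> E \<in> diff_ops k s t \<Longrightarrow> (\<lambda>u. D u + E u) \<in> diff_ops k s t"
proof (induction k arbitrary: D E)
  case 0
  interpret T: module t by (rule assms)
  from 0 show ?case
    by (simp add: linear_of_cx_iff[OF assms] T.scale_right_distrib algebra_simps)
next
  case (Suc k)
  interpret T: module t by (rule assms)
  have "(\<lambda>u. (D (s r u) - t r (D u)) + (E (s r u) - t r (E u))) \<in> diff_ops k s t" for r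
    using Suc by simp
  then have "(\<lambda>u. (D (s r u) + E (s r u)) - t r (D u + E u)) \<in> diff_ops k s t" for r
    by (simp add: T.scale_right_distrib algebra_simps)
  then show ?case
    using Suc.prems by (simp add: linear_of_cx_iff[OF assms] T.scale_right_distrib algebra_simps)
qed

lemma diff_ops_scale:
  assumes "module s" "module t"
  shows "D \<in> diff_ops k s t \<Longrightarrow> (\<lambda>u. t a (D u)) \<in> diff_ops k s t"
proof (induction k arbitrary: D)
  case 0
  interpret T: module t by (rule assms)
  from 0 show ?case
    by (simp add: linear_of_cx_iff[OF assms] T.scale_right_distrib mult.commute)
next
  case (Suc k)
  interpret T: module t by (rule assms)
  have "(\<lambda>u. t a (D (s r u) - t r (D u))) \<in> diff_ops k s t" for r
    using Suc by simp
  then have "(\<lambda>u. t a (D (s r u)) - t r (t a (D u))) \<in> diff_ops k s t" for r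
    by (simp add: T.scale_right_diff_distrib mult.commute[of a])
  then show ?case
    using Suc.prems by (simp add: linear_of_cx_iff[OF assms] T.scale_right_distrib mult.commute)
qed

lemma subspace_diff_ops:
  assumes "module s"
  shows "module.subspace (op_scale s) (diff_ops k s s)"
  unfolding module.subspace_def[OF module_op_scale[OF assms]]
  using diff_ops_zero[OF assms assms] diff_ops_add[OF assms assms] diff_ops_scale[OF assms assms]
  by (simp add: plus_fun_def zero_fun_def op_scale_def)

lemma diff_ops_0_subset_1:
  assumes "module s" "module t" "D \<in> diff_ops 0 s t"
  shows "D \<in> diff_ops 1 s t"
  using assms(3) diff_ops_zero[OF assms(1,2), of 0] by (simp del: diff_ops.simps(1)) simp

lemma scale_in_diff_ops:
  assumes "module s"
  shows "s b \<in> diff_ops 0 s s"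
proof -
  interpret S: module s by (rule assms)
  show ?thesis by (simp add: linear_of_cx_iff[OF assms assms] S.scale_right_distrib mult.commute)
qed

lemma derivation_in_diff_ops:
  assumes "module t" and \<delta>: "derivation t \<delta>"
  shows "\<delta> \<in> diff_ops 1 (*) t"
proof -
  interpret T: module t by (rule assms)
  show ?thesis
    by (simp add: linear_of_cx_iff[OF module_mult assms(1)] derivation_add[OF \<delta>]
        derivation_mult[OF \<delta>] derivation_of_cx[OF \<delta>] T.scale_left_distrib)
qed

text \<open>The commutator of \<open>D\<close> with \<open>a\<close> is linear over the ring, hence it is multiplication by its
  value at \<open>1\<close>, which is \<open>D a\<close>.\<close>

lemma derivation_if_diff_ops:
  assumes "module t" and D: "D \<in> diff_ops 1 (*) t" and const: "\<And>c. D (of_cx c) = 0"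
  shows "derivation t D"
proof -
  interpret T: module t by (rule assms)
  have "D (a * b) = t a (D b) + t b (D a)" for a b
  proof -
    have D1: "D 1 = 0" using const[of 1] by (simp add: of_cx_1)
    have "(\<lambda>u. D (a * u) - t a (D u)) \<in> diff_ops 0 (*) t" using D by simp
    then have "D (a * (b * 1)) - t a (D (b * 1)) - t b (D (a * 1) - t a (D 1)) = 0"
      by (simp del: mult_1_right mult_1_left)
    then show ?thesis by (simp add: D1 algebra_simps)
  qed
  then show ?thesis
    using diff_ops_linear(1)[OF module_mult assms(1) D] const by (intro derivationI)
qed

lemma diff_ops0_1:
  assumes "module t"
  shows "diff_ops0 1 t G = {\<delta>. derivation t \<delta> \<and> range \<delta> \<subseteq> G}"
  using derivation_in_diff_ops[OF assms] derivation_if_diff_ops[OF assms] derivation_of_cx[of t]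
  unfolding diff_ops0_def by blast

text \<open>The defect of the product rule is the symbol \<open>Q\<close> of \<open>D\<close>: the commutator of \<open>D\<close> with \<open>r\<close> is the
  multiplication by \<open>D r\<close> plus the derivation \<open>Q r\<close>, which is of order one.\<close>

lemma second_order_in_diff_ops:
  assumes "module t" and add: "\<And>a b. D (a + b) = D a + D b"
    and mult: "\<And>a b. D (a * b) = t a (D b) + t b (D a) + Q a b"
    and const: "\<And>c. D (of_cx c) = 0" "\<And>c b. Q (of_cx c) b = 0"
    and Q: "\<And>a. derivation t (Q a)"
  shows "D \<in> diff_ops 2 (*) t"
proof -
  interpret T: module t by (rule assms)
  have "(\<lambda>u. D (r * u) - t r (D u)) \<in> diff_ops 1 (*) t" for r
  proof -
    have "(\<lambda>u. t u (D r)) \<in> diff_ops 0 (*) t"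
      by (simp add: linear_of_cx_iff[OF module_mult assms(1)] T.scale_left_distrib)
    then have "(\<lambda>u. t u (D r) + Q r u) \<in> diff_ops 1 (*) t"
      by (intro diff_ops_add[OF module_mult assms(1)] diff_ops_0_subset_1[OF module_mult assms(1)]
          derivation_in_diff_ops[OF assms(1) Q])
    moreover have "(\<lambda>u. D (r * u) - t r (D u)) = (\<lambda>u. t u (D r) + Q r u)"
      by (rule ext) (simp add: mult add.assoc)
    ultimately show ?thesis by (simp only:)
  qed
  then have "D \<in> diff_ops (Suc 1) (*) t"
    by (simp only: diff_ops.simps(2) mem_Collect_eq linear_of_cx_iff[OF module_mult assms(1)])
      (simp add: add mult const)
  then show ?thesis by (simp only: numeral_2_eq_2 One_nat_def)
qed

text \<open>The defining conditions are equations between iterated commutators, and \<open>h\<close> commutes with forming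
  commutators. This identifies operators with values in \<open>B\<close> and operators with values in the
  multiplications on a line bundle.\<close>

lemma diff_ops_comp_inj:
  fixes h :: "'g::ab_group_add \<Rightarrow> 'h::ab_group_add"
  assumes s: "module s" and h: "module_hom t t' h" and inj: "inj h"
  shows "(\<lambda>u. h (D u)) \<in> diff_ops k s t' \<longleftrightarrow> D \<in> diff_ops k s t"
proof -
  interpret H: module_hom t t' h by (rule h)
  have t: "module t" "module t'" by unfold_locales
  have eq: "h x = h y \<longleftrightarrow> x = y" for x y using inj by (auto dest: injD)
  have eq0: "h x = 0 \<longleftrightarrow> x = 0" for x using eq[of x 0] by simp
  have lin: "Vector_Spaces.linear (\<lambda>c. s (of_cx c)) (\<lambda>c. t' (of_cx c)) (\<lambda>u. h (D u)) \<longleftrightarrow>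
      Vector_Spaces.linear (\<lambda>c. s (of_cx c)) (\<lambda>c. t (of_cx c)) D" for D
    by (simp add: linear_of_cx_iff s t H.add[symmetric] H.scale[symmetric] eq)
  have comm: "h (D (s r u)) - t' r (h (D u)) = h (D (s r u) - t r (D u))" for D r u
    by (simp add: H.diff H.scale)
  show ?thesis
    by (induction k arbitrary: D) (simp_all only: diff_ops.simps mem_Collect_eq lin comm eq0)
qed

section \<open>Universal property of the differentials\<close>

lemma pm_scale_single: "pm_scale c (Poly_Mapping.single a 1) = Poly_Mapping.single a c"
  by (rule poly_mapping_eqI) (simp add: lookup_pm_scale lookup_single when_def)

lemma abs_kaehler_single: "abs_kaehler (Poly_Mapping.single a c) = kscale c (kd a)"
  by (simp add: kscale.abs_eq kd.abs_eq pm_scale_single)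

lemma span_range_kd: "module.span kscale (range kd) = (UNIV :: 'a::complex_alg kaehler set)"
proof -
  interpret K: module "kscale :: 'a \<Rightarrow> _" by (rule module_kscale)
  have "abs_kaehler u \<in> K.span (range kd)" for u :: "'a \<Rightarrow>\<^sub>0 'a"
    by (induction u rule: poly_mapping_add_induct)
      (simp_all add: zero_kaehler.abs_eq[symmetric] plus_kaehler.abs_eq[symmetric]
        abs_kaehler_single K.span_zero K.span_add K.span_scale K.span_base)
  then have "w \<in> K.span (range kd)" for w :: "'a kaehler"
    by (induction w rule: kaehler.abs_induct)
  then show ?thesis by auto
qed

lemma derivation_kd: "derivation kscale (kd :: 'a::complex_alg \<Rightarrow> _)"
proof (rule derivationI)
  have rel: "kaehler_eq u v" if "u - v \<in> kaehler_rels" for u v :: "'a \<Rightarrow>\<^sub>0 'a"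
    using that unfolding kaehler_eq_def by (rule module.span_base[OF module_pm_scale])
  fix x y :: 'a
  show "kd (x + y) = kd x + kd y"
    by transfer (rule rel, unfold kaehler_rels_def diff_diff_eq[symmetric], blast)
  show "kd (x * y) = kscale x (kd y) + kscale y (kd x)"
    by transfer (rule rel, unfold kaehler_rels_def diff_diff_eq[symmetric] pm_scale_single, blast)
  fix c
  show "kd (of_cx c :: 'a) = 0"
    by transfer (rule rel, unfold kaehler_rels_def diff_0_right, blast)
qed

text \<open>On the free module \<open>h\<close> has to be \<open>H\<close>, which kills the three kinds of relations exactly because
  \<open>\<delta>\<close> is additive, obeys the product rule and vanishes on constants.\<close>

lemma derivation_factors_through_kd:
  fixes \<delta> :: "'a::complex_alg \<Rightarrow> 'g::ab_group_add"
  assumes t: "module t" and \<delta>: "derivation t \<delta>"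
  shows "\<exists>h. module_hom kscale t h \<and> (\<forall>a. h (kd a) = \<delta> a)"
proof -
  interpret T: module t by (rule t)
  define H where "H u = (\<Sum>a\<in>Poly_Mapping.keys u. t (Poly_Mapping.lookup u a) (\<delta> a))" for u
  have H_superset: "H u = (\<Sum>a\<in>V. t (Poly_Mapping.lookup u a) (\<delta> a))"
    if "finite V" "Poly_Mapping.keys u \<subseteq> V" for u V
    unfolding H_def
    by (rule sum.mono_neutral_left[OF that]) (simp add: not_in_keys_iff_lookup_eq_zero)
  have H_add: "H (u + v) = H u + H v" for u v
    using keys_add[of u v]
    by (simp add: H_superset[of "Poly_Mapping.keys u \<union> Poly_Mapping.keys v"] lookup_add
        T.scale_left_distrib sum.distrib)
  have H_scale: "H (pm_scale r u) = t r (H u)" for r u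
  proof -
    have "Poly_Mapping.keys (pm_scale r u) \<subseteq> Poly_Mapping.keys u"
      by (auto simp: in_keys_iff lookup_pm_scale)
    then show ?thesis
      by (simp add: H_superset[of "Poly_Mapping.keys u"] lookup_pm_scale T.scale_sum_right)
  qed
  interpret H: module_hom pm_scale t H
    by (intro module_hom.intro module_hom_axioms.intro module_pm_scale t H_add H_scale)
  have H_single: "H (Poly_Mapping.single a c) = t c (\<delta> a)" for a c
    by (simp add: H_superset[of "{a}"])
  have H_rels: "H u = 0" if "u \<in> kaehler_rels" for u
    using that unfolding kaehler_rels_def
    by (auto simp: H.diff H_single derivation_add[OF \<delta>] derivation_mult[OF \<delta>]
        derivation_of_cx[OF \<delta>])
  have H_eq: "H u = H v" if "kaehler_eq u v" for u v
  proof -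
    have "H (u - v) = 0"
      using H_rels that unfolding kaehler_eq_def by (rule H.eq_0_on_span)
    then show ?thesis by (simp add: H.diff)
  qed
  define h where "h w = H (rep_kaehler w)" for w
  have h_abs: "h (abs_kaehler u) = H u" for u
    unfolding h_def
    by (rule H_eq) (metis Quotient3_kaehler Quotient3_abs_rep kaehler.abs_eq_iff)
  have "module_hom kscale t h"
  proof (intro module_hom.intro module_hom_axioms.intro module_kscale t)
    fix v w r
    show "h (v + w) = h v + h w"
      by (induction v rule: kaehler.abs_induct, induction w rule: kaehler.abs_induct)
        (simp add: plus_kaehler.abs_eq h_abs H_add)
    show "h (kscale r v) = t r (h v)"
      by (induction v rule: kaehler.abs_induct) (simp add: kscale.abs_eq h_abs H_scale)
  qed
  moreover have "h (kd a) = \<delta> a" for a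
    by (simp add: kd.abs_eq h_abs H_single)
  ultimately show ?thesis by blast
qed

section \<open>Differentials restricted to a closed subvariety\<close>

lemma kres_eq_iff:
  "kres \<pi> v = kres \<pi> w \<longleftrightarrow> v - w \<in> module.span kscale {kscale i u | i u. i \<in> ker \<pi>}"
  (is "_ \<longleftrightarrow> _ \<in> ?N")
proof
  interpret K: module "kscale :: 'a::complex_alg \<Rightarrow> _" by (rule module_kscale)
  have self: "v \<in> kres \<pi> v" by (simp add: kres_def K.span_zero)
  show "v - w \<in> ?N" if eq: "kres \<pi> v = kres \<pi> w"
  proof -
    have "v \<in> kres \<pi> w" using self by (simp only: eq)
    then show ?thesis by (simp add: kres_def)
  qed
  assume d: "v - w \<in> ?N"
  have "u - v \<in> ?N \<longleftrightarrow> u - w \<in> ?N" for u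
    using K.span_add[OF _ d, of "u - v"] K.span_diff[OF _ d, of "u - w"] by auto
  then show "kres \<pi> v = kres \<pi> w" by (simp add: kres_def)
qed

text \<open>A derivation of \<open>A\<close> corresponds to an \<open>A\<close>-linear map on the differentials. If its target is a
  \<open>B\<close>-module, this map kills the multiples by elements of \<open>I\<close>, so it descends to the restriction to
  the subvariety.\<close>

lemma bij_betw_hom_kres_derivations:
  fixes \<pi> :: "'a::complex_alg \<Rightarrow> 'b::complex_alg" and t :: "'b \<Rightarrow> 'g::ab_group_add \<Rightarrow> 'g"
  assumes \<pi>: "complex_alg_hom \<pi>" and t: "module t" and G: "module.subspace t G"
  shows "bij_betw (\<lambda>\<rho> a. \<rho> (kd_res \<pi> a)) (hom_kres \<pi> t G) (diff_ops0 1 (\<lambda>a. t (\<pi> a)) G)"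
proof -
  interpret T: module t by (rule t)
  interpret K: module "kscale :: 'a \<Rightarrow> _" by (rule module_kscale)
  have t\<pi>: "module (\<lambda>a. t (\<pi> a))" by (rule module_restrict_scalars[OF \<pi> t])
  let ?D = "{\<delta>. derivation (\<lambda>a. t (\<pi> a)) \<delta> \<and> range \<delta> \<subseteq> G}"
  have hom: "module_hom kscale (\<lambda>a. t (\<pi> a)) (\<lambda>w. \<rho> (kres \<pi> w))" if "\<rho> \<in> hom_kres \<pi> t G" for \<rho>
    using that by (intro module_hom.intro module_hom_axioms.intro module_kscale t\<pi>)
      (auto simp: hom_kres_def)
  have "bij_betw (\<lambda>\<rho> a. \<rho> (kd_res \<pi> a)) (hom_kres \<pi> t G) ?D"
    unfolding bij_betw_def
  proof (intro conjI)
    show "inj_on (\<lambda>\<rho> a. \<rho> (kd_res \<pi> a)) (hom_kres \<pi> t G)"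
    proof (rule inj_onI)
      fix \<rho> \<rho>' assume \<rho>: "\<rho> \<in> hom_kres \<pi> t G" and \<rho>': "\<rho>' \<in> hom_kres \<pi> t G"
        and eq: "(\<lambda>a. \<rho> (kd_res \<pi> a)) = (\<lambda>a. \<rho>' (kd_res \<pi> a))"
      have "\<rho> (kres \<pi> w) = \<rho>' (kres \<pi> w)" for w
      proof (rule module_pair.module_hom_eq_on_span[OF module_pair.intro[OF module_kscale t\<pi>] hom[OF \<rho>] hom[OF \<rho>']])
        show "w \<in> K.span (range kd)" by (simp add: span_range_kd)
        show "\<rho> (kres \<pi> x) = \<rho>' (kres \<pi> x)" if "x \<in> range kd" for x
          using that eq by (auto simp: kd_res_def fun_eq_iff)
      qed
      then show "\<rho> = \<rho>'"
        using \<rho> \<rho>' unfolding hom_kres_def by (intro PiE_ext[of _ "range (kres \<pi>)" "\<lambda>_. G"]) auto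
    qed
    show "(\<lambda>\<rho> a. \<rho> (kd_res \<pi> a)) ` hom_kres \<pi> t G = ?D"
    proof (intro equalityI subsetI)
      fix \<delta> assume "\<delta> \<in> (\<lambda>\<rho> a. \<rho> (kd_res \<pi> a)) ` hom_kres \<pi> t G"
      then obtain \<rho> where \<rho>: "\<rho> \<in> hom_kres \<pi> t G" and \<delta>: "\<delta> = (\<lambda>a. \<rho> (kres \<pi> (kd a)))"
        by (auto simp: kd_res_def)
      interpret R: module_hom kscale "\<lambda>a. t (\<pi> a)" "\<lambda>w. \<rho> (kres \<pi> w)" by (rule hom[OF \<rho>])
      have "derivation (\<lambda>a. t (\<pi> a)) \<delta>"
        unfolding \<delta> by (rule derivationI)
          (simp_all only: derivation_add[OF derivation_kd] derivation_mult[OF derivation_kd]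
            derivation_of_cx[OF derivation_kd] R.add R.scale R.zero)
      moreover have "range \<delta> \<subseteq> G" using \<rho> by (auto simp: \<delta> hom_kres_def)
      ultimately show "\<delta> \<in> ?D" by simp
    next
      fix \<delta> assume "\<delta> \<in> ?D"
      then have \<delta>: "derivation (\<lambda>a. t (\<pi> a)) \<delta>" and "range \<delta> \<subseteq> G" by auto
      obtain h where h: "module_hom kscale (\<lambda>a. t (\<pi> a)) h" and h_kd: "\<And>a. h (kd a) = \<delta> a"
        using derivation_factors_through_kd[OF t\<pi> \<delta>] by blast
      interpret H: module_hom kscale "\<lambda>a. t (\<pi> a)" h by (rule h)
      have h_N: "h u = 0" if "u \<in> K.span {kscale i v | i v. i \<in> ker \<pi>}" for u
        using _ that by (rule H.eq_0_on_span) (auto simp: H.scale ker_def)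
      have h_G: "h w \<in> G" for w
      proof -
        have "w \<in> K.span (range kd)" by (simp add: span_range_kd)
        then show ?thesis
        proof (induction rule: K.span_induct_alt)
          case base then show ?case using G by (simp add: T.subspace_0)
        next
          case (step c x y)
          then have "h x \<in> G" using h_kd \<open>range \<delta> \<subseteq> G\<close> by auto
          then show ?case
            using step G by (simp add: H.add H.scale T.subspace_add T.subspace_scale)
        qed
      qed
      \<comment> \<open>Outside the cosets the value has to be \<open>undefined\<close>, as elements of \<open>hom_kres\<close> are extensional.\<close>
      define \<rho> where "\<rho> = restrict (\<lambda>W. h (SOME w. W = kres \<pi> w)) (range (kres \<pi>))"
      have \<rho>: "\<rho> (kres \<pi> w) = h w" for w
      proof -
        have "kres \<pi> w = kres \<pi> (SOME w'. kres \<pi> w = kres \<pi> w')" by (rule someI) (rule refl)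
        then have "h (w - (SOME w'. kres \<pi> w = kres \<pi> w')) = 0"
          by (intro h_N) (simp only: kres_eq_iff[symmetric])
        then show ?thesis by (simp add: \<rho>_def H.diff)
      qed
      have "\<rho> \<in> hom_kres \<pi> t G"
        unfolding hom_kres_def
      proof (intro CollectI conjI allI)
        show "\<rho> \<in> range (kres \<pi>) \<rightarrow>\<^sub>E G"
          using h_G by (auto simp: \<rho> ) (simp add: \<rho>_def)
      qed (simp_all add: \<rho> H.add H.scale)
      moreover have "\<delta> = (\<lambda>a. \<rho> (kd_res \<pi> a))" by (simp add: kd_res_def \<rho> h_kd)
      ultimately show "\<delta> \<in> (\<lambda>\<rho> a. \<rho> (kd_res \<pi> a)) ` hom_kres \<pi> t G" by blast
    qed
  qed
  then show ?thesis by (simp only: diff_ops0_1[OF t\<pi>])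
qed

section \<open>Line bundles\<close>

text \<open>Up to the factor \<open>g\<close>, \<open>L\<close> is free with basis \<open>e\<close>. In contrast to the definition of a line bundle,
  \<open>g\<close> depends neither on the section \<open>l\<close> nor on the coefficient \<open>b\<close>.\<close>

definition trivialises :: "('b::comm_ring_1 \<Rightarrow> 'l::ab_group_add \<Rightarrow> 'l) \<Rightarrow> 'b \<Rightarrow> 'l \<Rightarrow> bool" where
  "trivialises s g e \<longleftrightarrow> (\<forall>l. \<exists>b. s g l = s b e) \<and> (\<forall>b. s b e = 0 \<longrightarrow> g * b = 0)"

lemma line_bundle_local_generators:
  assumes L: "line_bundle s"
  shows "\<exists>F e. finite F \<and> 1 \<in> module.span (*) F \<and>
    (\<forall>f\<in>F. (\<forall>l. \<exists>k b. s (f ^ k) l = s b (e f)) \<and> (\<forall>b. s b (e f) = 0 \<longrightarrow> (\<exists>k. f ^ k * b = 0)))"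
proof -
  interpret M: module "(*) :: 'a \<Rightarrow> 'a \<Rightarrow> 'a" by (rule module_mult)
  define good where "good f e \<longleftrightarrow>
    (\<forall>l. \<exists>k b. s (f ^ k) l = s b e) \<and> (\<forall>b. s b e = 0 \<longrightarrow> (\<exists>k. f ^ k * b = 0))" for f e
  let ?W = "{f. \<exists>e. good f e}"
  have "1 \<in> M.span ?W"
  proof (rule ideal_local_global)
    show "M.subspace (M.span ?W)" by (rule M.subspace_span)
    fix p :: "'a set" assume "prime_ideal p"
    then obtain f e where "f \<notin> p" "good f e"
      using L unfolding line_bundle_def good_def by blast
    then show "\<exists>f\<in>M.span ?W. f \<notin> p" using M.span_base[of f ?W] by blast
  qed
  then obtain F u where F: "finite F" "F \<subseteq> ?W" and u: "1 = (\<Sum>f\<in>F. u f * f)"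
    unfolding M.span_explicit by blast
  have "1 \<in> M.span F"
    unfolding u by (intro M.span_sum M.span_scale M.span_base)
  moreover obtain e where "\<forall>f\<in>F. good f (e f)"
    using bchoice[of F good] F(2) by blast
  ultimately show ?thesis
    using F(1) unfolding good_def by (intro exI[of _ F] exI[of _ e]) simp
qed

text \<open>The exponents in the definition of a line bundle become uniform. First, by a partition of
  unity, the finitely many local generators generate \<open>L\<close>, so one exponent \<open>K\<close> serves for all sections.
  Next, an element killing \<open>L\<close> is killed by a power of every \<open>f\<close> of the cover, so it is zero.
  Finally, faithfulness bounds the exponents in the relations \<open>s b e = 0\<close>.\<close>

lemma
  fixes s :: "'b::complex_alg \<Rightarrow> 'l::ab_group_add \<Rightarrow> 'l"
  assumes L: "line_bundle s"
  shows line_bundle_trivialised: "1 \<in> module.span (*) {g. \<exists>e. trivialises s g e}"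
    and line_bundle_faithful: "(\<forall>l. s b l = 0) \<Longrightarrow> b = 0"
proof -
  interpret M: module "(*) :: 'b \<Rightarrow> 'b \<Rightarrow> 'b" by (rule module_mult)
  interpret S: module s using L by (simp add: line_bundle_def)
  obtain F e where loc: "finite F \<and> 1 \<in> M.span F \<and>
    (\<forall>f\<in>F. (\<forall>l. \<exists>k b. s (f ^ k) l = s b (e f)) \<and> (\<forall>b. s b (e f) = 0 \<longrightarrow> (\<exists>k. f ^ k * b = 0)))"
    using line_bundle_local_generators[OF L] by (elim exE) (rule that)
  have F: "finite F" "1 \<in> M.span F"
    by (rule conjunct1[OF loc], rule conjunct1[OF conjunct2[OF loc]])
  have local_gen: "\<forall>f\<in>F. \<forall>l. \<exists>k b. s (f ^ k) l = s b (e f)"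
    and local_free: "\<forall>f\<in>F. \<forall>b. s b (e f) = 0 \<longrightarrow> (\<exists>k. f ^ k * b = 0)"
    by (intro ballI, rule conjunct1[OF bspec[OF conjunct2[OF conjunct2[OF loc]]]], assumption,
        intro ballI, rule conjunct2[OF bspec[OF conjunct2[OF conjunct2[OF loc]]]], assumption)
  have unit: "\<exists>u. (\<Sum>f\<in>F. u f * f ^ k f) = 1" for k
    using unit_ideal_eq_one[OF F(1) unit_ideal_powers[OF F(2)], of k] .
  have generate: "\<exists>c. l = (\<Sum>f\<in>F. s (c f) (e f))" for l
  proof -
    have "\<forall>f\<in>F. \<exists>k. \<exists>b. s (f ^ k) l = s b (e f)" using local_gen by blast
    then obtain k where "\<forall>f\<in>F. \<exists>b. s (f ^ k f) l = s b (e f)" by (rule bchoice[THEN exE])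
    then obtain b where b: "\<forall>f\<in>F. s (f ^ k f) l = s (b f) (e f)" by (rule bchoice[THEN exE])
    obtain u where u: "(\<Sum>f\<in>F. u f * f ^ k f) = 1" using unit[of k] by (elim exE)
    have "l = s (\<Sum>f\<in>F. u f * f ^ k f) l" by (simp add: u)
    also have "\<dots> = (\<Sum>f\<in>F. s (u f) (s (f ^ k f) l))" by (simp add: S.scale_sum_left)
    also have "\<dots> = (\<Sum>f\<in>F. s (u f * b f) (e f))" using b by (intro sum.cong) auto
    finally show ?thesis by (rule exI[of _ "\<lambda>f. u f * b f"])
  qed
  show faithful: "b = 0" if b: "\<forall>l. s b l = 0" for b
  proof -
    have "\<forall>f\<in>F. \<exists>k. f ^ k * b = 0" using local_free b by blast
    then obtain k where k: "\<forall>f\<in>F. f ^ k f * b = 0" by (rule bchoice[THEN exE])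
    obtain u where u: "(\<Sum>f\<in>F. u f * f ^ k f) = 1" using unit[of k] by (elim exE)
    have "b = (\<Sum>f\<in>F. u f * f ^ k f) * b" by (simp only: u mult_1)
    also have "\<dots> = (\<Sum>f\<in>F. u f * (f ^ k f * b))" by (simp only: sum_distrib_right mult.assoc)
    also have "\<dots> = 0" by (intro sum.neutral ballI) (simp add: bspec[OF k])
    finally show ?thesis .
  qed
  have "\<exists>K. trivialises s (f ^ K) (e f)" if f: "f \<in> F" for f
  proof -
    have "\<forall>h\<in>F. \<exists>k. \<exists>b. s (f ^ k) (e h) = s b (e f)" using local_gen f by blast
    then obtain k where "\<forall>h\<in>F. \<exists>b. s (f ^ k h) (e h) = s b (e f)" by (rule bchoice[THEN exE])
    then obtain b where b: "\<forall>h\<in>F. s (f ^ k h) (e h) = s (b h) (e f)" by (rule bchoice[THEN exE])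
    define K where "K = sum k F"
    have K: "s (f ^ K) (e h) = s (f ^ (K - k h) * b h) (e f)" if "h \<in> F" for h
    proof -
      have "k h \<le> K" unfolding K_def using F(1) that by (rule member_le_sum[rotated 2]) simp
      then have "f ^ K = f ^ (K - k h) * f ^ k h" by (simp flip: power_add)
      then show ?thesis using b that by (simp flip: S.scale_scale)
    qed
    have mult_gen: "\<exists>b. s (f ^ K) l = s b (e f)" for l
    proof -
      obtain c where l: "l = (\<Sum>h\<in>F. s (c h) (e h))" using generate by blast
      have "s (f ^ K) l = (\<Sum>h\<in>F. s (c h) (s (f ^ K) (e h)))"
        by (simp add: l S.scale_sum_right mult.commute)
      also have "\<dots> = (\<Sum>h\<in>F. s (c h * (f ^ (K - k h) * b h)) (e f))"
        by (rule sum.cong) (simp_all add: K)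
      also have "\<dots> = s (\<Sum>h\<in>F. c h * (f ^ (K - k h) * b h)) (e f)"
        by (simp only: S.scale_sum_left)
      finally show ?thesis by (rule exI)
    qed
    \<comment> \<open>If \<open>b\<close> kills the generator, \<open>f ^ K * b\<close> kills all of \<open>L\<close>: the exponent does not depend on \<open>b\<close>.\<close>
    moreover have "f ^ K * c = 0" if "s c (e f) = 0" for c
    proof (rule faithful, intro allI)
      fix l
      obtain d where "s (f ^ K) l = s d (e f)" using mult_gen by blast
      then have "s (c * f ^ K) l = s c (s d (e f))" by (simp flip: S.scale_scale)
      also have "\<dots> = s d (s c (e f))" by (simp add: mult.commute)
      finally show "s (f ^ K * c) l = 0" by (simp add: that mult.commute)
    qed
    ultimately show ?thesis unfolding trivialises_def by blast
  qed
  then have "\<forall>f\<in>F. \<exists>K. trivialises s (f ^ K) (e f)" by blast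
  then obtain K where "\<forall>f\<in>F. trivialises s (f ^ K f) (e f)" by (rule bchoice[THEN exE])
  then have "(\<lambda>f. f ^ K f) ` F \<subseteq> {g. \<exists>e. trivialises s g e}" by blast
  from M.span_mono[OF this] show "1 \<in> M.span {g. \<exists>e. trivialises s g e}"
    using unit_ideal_powers[OF F(2), of K] by blast
qed

text \<open>Constructions on \<open>L\<close> that are available in a local frame cost two factors of \<open>g\<close>: one to write a
  section in the frame, and another to make its coefficient unique or to write a second section.\<close>

lemma line_bundle_local_global:
  fixes s :: "'b::complex_alg \<Rightarrow> 'l::ab_group_add \<Rightarrow> 'l"
  assumes L: "line_bundle s" and J: "module.subspace (*) J"
    and sq: "\<And>g e. trivialises s g e \<Longrightarrow> g ^ 2 \<in> J"
  shows "1 \<in> J"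
proof -
  interpret M: module "(*) :: 'b \<Rightarrow> 'b \<Rightarrow> 'b" by (rule module_mult)
  have "(\<lambda>g. g ^ 2) ` {g. \<exists>e. trivialises s g e} \<subseteq> J" using sq by blast
  then show ?thesis
    using unit_ideal_powers[OF line_bundle_trivialised[OF L], of "\<lambda>_. 2"] M.span_minimal[OF _ J]
    by blast
qed

text \<open>In a local frame, \<open>T\<close> is determined by the coefficient \<open>c\<close> of \<open>T e\<close>.\<close>

lemma line_bundle_endomorphism:
  fixes s :: "'b::complex_alg \<Rightarrow> 'l::ab_group_add \<Rightarrow> 'l"
  assumes L: "line_bundle s" and T: "\<And>b l. T (s b l) = s b (T l)"
  shows "\<exists>b. \<forall>l. T l = s b l"
proof -
  interpret S: module s using L by (simp add: line_bundle_def)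
  define J where "J = {r. \<exists>c. \<forall>l. s r (T l) = s c l}"
  have "1 \<in> J"
  proof (rule line_bundle_local_global[OF L])
    show "module.subspace (*) J"
      unfolding ideal_iff
    proof (intro conjI ballI allI)
      show "0 \<in> J" unfolding J_def by (intro CollectI exI[of _ 0]) simp
    next
      fix x y assume "x \<in> J" "y \<in> J"
      then obtain c d where "\<forall>l. s x (T l) = s c l" "\<forall>l. s y (T l) = s d l"
        by (auto simp: J_def)
      then show "x + y \<in> J"
        unfolding J_def by (intro CollectI exI[of _ "c + d"]) (simp add: S.scale_left_distrib)
    next
      fix r x assume "x \<in> J"
      then obtain c where "\<forall>l. s x (T l) = s c l" by (auto simp: J_def)
      then show "r * x \<in> J"
        unfolding J_def by (intro CollectI exI[of _ "r * c"]) (simp flip: S.scale_scale)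
    qed
    fix g e assume "trivialises s g e"
    then have gen: "\<And>l. \<exists>b. s g l = s b e" by (simp add: trivialises_def)
    obtain c where c: "s g (T e) = s c e" using gen by blast
    have "s (g ^ 2) (T l) = s (c * g) l" for l
    proof -
      obtain b where b: "s g l = s b e" using gen by blast
      have "s (g ^ 2) (T l) = s g (T (s g l))" by (simp add: T power2_eq_square)
      also have "\<dots> = s b (s g (T e))" by (simp add: b T mult.commute)
      also have "\<dots> = s c (s b e)" by (simp add: c mult.commute)
      also have "\<dots> = s (c * g) l" by (simp flip: b)
      finally show ?thesis .
    qed
    then show "g ^ 2 \<in> J" unfolding J_def by blast
  qed
  then show ?thesis by (simp add: J_def)
qed

text \<open>A covariant derivative along \<open>\<theta>\<close>. In a local frame it differentiates the coefficient, and
  covariant derivatives along multiples of \<open>\<theta>\<close> are glued by a partition of unity.\<close>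

lemma line_bundle_connection:
  fixes s :: "'b::complex_alg \<Rightarrow> 'l::ab_group_add \<Rightarrow> 'l"
  assumes L: "line_bundle s" and \<theta>: "derivation (*) \<theta>"
  shows "\<exists>D. (\<forall>l l'. D (l + l') = D l + D l') \<and>
    (\<forall>b l. D (s b l) = s b (D l) + s (\<theta> b) l)"
proof -
  interpret S: module s using L by (simp add: line_bundle_def)
  define J where "J = {r. \<exists>D. (\<forall>l l'. D (l + l') = D l + D l') \<and>
    (\<forall>b l. D (s b l) = s b (D l) + s (r * \<theta> b) l)}"
  have "1 \<in> J"
  proof (rule line_bundle_local_global[OF L])
    show "module.subspace (*) J"
      unfolding ideal_iff
    proof (intro conjI ballI allI)
      show "0 \<in> J" unfolding J_def by (intro CollectI exI[of _ "\<lambda>_. 0"]) simp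
    next
      fix x y assume "x \<in> J" "y \<in> J"
      then obtain D D' where "\<forall>l l'. D (l + l') = D l + D l'"
        "\<forall>b l. D (s b l) = s b (D l) + s (x * \<theta> b) l"
        "\<forall>l l'. D' (l + l') = D' l + D' l'"
        "\<forall>b l. D' (s b l) = s b (D' l) + s (y * \<theta> b) l"
        unfolding J_def by (elim CollectE exE conjE) (rule that)
      then show "x + y \<in> J"
        unfolding J_def
        by (intro CollectI exI[of _ "\<lambda>l. D l + D' l"])
          (simp add: S.scale_left_distrib S.scale_right_distrib distrib_right add_ac)
    next
      fix r x assume "x \<in> J"
      then obtain D where "\<forall>l l'. D (l + l') = D l + D l'"
        "\<forall>b l. D (s b l) = s b (D l) + s (x * \<theta> b) l"
        unfolding J_def by (elim CollectE exE conjE) (rule that)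
      then show "r * x \<in> J"
        unfolding J_def
        by (intro CollectI exI[of _ "\<lambda>l. s r (D l)"])
          (simp add: S.scale_right_distrib mult_ac)
    qed
    fix g e assume tr: "trivialises s g e"
    then have "\<forall>l. \<exists>b. s g l = s b e" by (simp add: trivialises_def)
    then obtain c where c: "\<And>l. s g l = s (c l) e" by metis
    have cancel: "g * b = g * b'" if "s b e = s b' e" for b b'
    proof -
      have "s (b - b') e = 0" using that by (simp add: S.scale_left_diff_distrib)
      then have "g * (b - b') = 0" using tr by (simp add: trivialises_def)
      then show ?thesis by (simp add: right_diff_distrib)
    qed
    \<comment> \<open>The coordinate of \<open>g\<^sup>2 l\<close> in the local frame \<open>e\<close>, differentiated coefficientwise.\<close>
    define \<phi> where "\<phi> l = g * c l" for l
    have \<phi>_add: "\<phi> (l + l') = \<phi> l + \<phi> l'" for l l'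
    proof -
      have "s (c (l + l')) e = s (c l + c l') e"
        by (simp add: S.scale_left_distrib S.scale_right_distrib flip: c)
      from cancel[OF this] show ?thesis by (simp add: \<phi>_def distrib_left)
    qed
    have \<phi>_scale: "\<phi> (s b l) = b * \<phi> l" for b l
    proof -
      have "s (c (s b l)) e = s b (s (c l) e)" by (simp add: mult.commute flip: c)
      then have "s (c (s b l)) e = s (b * c l) e" by simp
      from cancel[OF this] show ?thesis by (simp add: \<phi>_def mult.left_commute)
    qed
    have \<phi>_frame: "s (\<phi> l) e = s (g ^ 2) l" for l
    proof -
      have "s (\<phi> l) e = s g (s (c l) e)" by (simp add: \<phi>_def)
      then show ?thesis by (simp add: power2_eq_square flip: c)
    qed
    show "g ^ 2 \<in> J"
      unfolding J_def
    proof (intro CollectI exI[of _ "\<lambda>l. s (\<theta> (\<phi> l)) e"] conjI allI)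
      fix l l' show "s (\<theta> (\<phi> (l + l'))) e = s (\<theta> (\<phi> l)) e + s (\<theta> (\<phi> l')) e"
        by (simp add: \<phi>_add derivation_add[OF \<theta>] S.scale_left_distrib)
    next
      fix b l
      have "s (\<theta> (\<phi> (s b l))) e = s b (s (\<theta> (\<phi> l)) e) + s (\<theta> b) (s (\<phi> l) e)"
        by (simp add: \<phi>_scale derivation_mult[OF \<theta>] S.scale_left_distrib mult.commute)
      then show "s (\<theta> (\<phi> (s b l))) e = s b (s (\<theta> (\<phi> l)) e) + s (g ^ 2 * \<theta> b) l"
        by (simp add: \<phi>_frame mult.commute)
    qed
  qed
  then show ?thesis by (simp add: J_def)
qed

lemma bij_betw_line_bundle_multipliers:
  fixes \<pi> :: "'a::complex_alg \<Rightarrow> 'b::complex_alg" and s :: "'b \<Rightarrow> 'l::ab_group_add \<Rightarrow> 'l"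
  assumes \<pi>: "complex_alg_hom \<pi>" and L: "line_bundle s"
  shows "bij_betw (\<lambda>\<psi> a l. s (\<psi> a) l)
    (diff_ops0 k (\<lambda>a b. \<pi> a * b) UNIV) (diff_ops0 k (\<lambda>a. op_scale s (\<pi> a)) (diff_ops 0 s s))"
proof -
  have s: "module s" using L by (simp add: line_bundle_def)
  interpret S: module s by (rule s)
  have hom: "module_hom (\<lambda>a b. \<pi> a * b) (\<lambda>a. op_scale s (\<pi> a)) s"
    by (intro module_hom.intro module_hom_axioms.intro module_restrict_scalars[OF \<pi>] module_mult
        module_op_scale s) (simp_all add: fun_eq_iff S.scale_left_distrib op_scale_def)
  have inj: "inj s"
  proof (rule injI)
    fix b b' assume "s b = s b'"
    then have "\<forall>l. s (b - b') l = 0" by (simp add: S.scale_left_diff_distrib)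
    then have "b - b' = 0" by (rule line_bundle_faithful[OF L])
    then show "b = b'" by simp
  qed
  have s_eq_0: "s b = 0 \<longleftrightarrow> b = 0" for b
    using inj_eq[OF inj, of b 0] by (simp add: fun_eq_iff zero_fun_def)
  have in_ops: "(\<lambda>a. s (\<psi> a)) \<in> diff_ops k (*) (\<lambda>a. op_scale s (\<pi> a)) \<longleftrightarrow>
      \<psi> \<in> diff_ops k (*) (\<lambda>a b. \<pi> a * b)" for \<psi>
    by (rule diff_ops_comp_inj[OF module_mult hom inj])
  show ?thesis
    unfolding bij_betw_def
  proof (intro conjI equalityI subsetI)
    show "inj_on (\<lambda>\<psi> a l. s (\<psi> a) l) (diff_ops0 k (\<lambda>a b. \<pi> a * b) UNIV)"
      by (rule inj_onI) (simp add: fun_eq_iff injD[OF inj] inj_eq[OF inj, symmetric])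
  next
    fix E assume "E \<in> (\<lambda>\<psi> a l. s (\<psi> a) l) ` diff_ops0 k (\<lambda>a b. \<pi> a * b) UNIV"
    then show "E \<in> diff_ops0 k (\<lambda>a. op_scale s (\<pi> a)) (diff_ops 0 s s)"
      using scale_in_diff_ops[OF s] by (auto simp: diff_ops0_def in_ops s_eq_0 simp del: diff_ops.simps)
  next
    fix E assume E: "E \<in> diff_ops0 k (\<lambda>a. op_scale s (\<pi> a)) (diff_ops 0 s s)"
    have "\<exists>b. E a = s b" for a
    proof -
      have "E a \<in> diff_ops 0 s s" using E unfolding diff_ops0_def by blast
      then have "\<exists>b. \<forall>l. E a l = s b l" by (intro line_bundle_endomorphism[OF L]) simp
      then show ?thesis by (simp add: fun_eq_iff)
    qed
    then obtain \<psi> where \<psi>: "E = (\<lambda>a. s (\<psi> a))" by metis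
    have "\<psi> \<in> diff_ops0 k (\<lambda>a b. \<pi> a * b) UNIV"
      using E by (simp add: diff_ops0_def \<psi> in_ops s_eq_0)
    then show "E \<in> (\<lambda>\<psi> a l. s (\<psi> a) l) ` diff_ops0 k (\<lambda>a b. \<pi> a * b) UNIV"
      unfolding \<psi> by (rule imageI)
  qed
qed

section \<open>Derivations into the subvariety\<close>

lemma derivation_comp_hom:
  assumes "complex_alg_hom \<pi>" and \<theta>: "derivation (*) \<theta>"
  shows "derivation (\<lambda>a b. \<pi> a * b) (\<lambda>a. \<theta> (\<pi> a))"
  by (rule derivationI)
    (simp_all add: complex_alg_hom_simps[OF assms(1)] derivation_add[OF \<theta>] derivation_mult[OF \<theta>]
      derivation_of_cx[OF \<theta>])

lemma derivation_lincomb: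
  assumes t: "module t" and \<delta>: "\<And>k. k \<in> K \<Longrightarrow> derivation (\<lambda>a. t (\<pi> a)) (\<delta> k)"
  shows "derivation (\<lambda>a. t (\<pi> a)) (\<lambda>a. \<Sum>k\<in>K. t (c k) (\<delta> k a))"
proof -
  interpret T: module t by (rule t)
  show ?thesis
    by (rule derivationI)
      (simp_all add: derivation_add[OF \<delta>] derivation_mult[OF \<delta>] derivation_of_cx[OF \<delta>]
        T.scale_right_distrib T.scale_sum_right sum.distrib mult.commute)
qed

lemma derivation_diff_fun:
  assumes t: "module t" and \<delta>: "derivation t \<delta>" "derivation t \<epsilon>"
  shows "derivation t (\<lambda>a. \<delta> a - \<epsilon> a)"
proof -
  interpret T: module t by (rule t)
  show ?thesis
    by (rule derivationI)
      (simp_all add: derivation_add[OF \<delta>(1)] derivation_mult[OF \<delta>(1)] derivation_of_cx[OF \<delta>(1)]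
        derivation_add[OF \<delta>(2)] derivation_mult[OF \<delta>(2)] derivation_of_cx[OF \<delta>(2)]
        T.scale_right_diff_distrib)
qed

text \<open>The value at \<open>\<pi> a\<close> does not depend on the choice of \<open>a\<close>, as preimages differ by elements of the
  kernel.\<close>

lemma derivation_descends:
  assumes \<pi>: "complex_alg_hom \<pi>" "surj \<pi>"
    and \<delta>: "derivation (\<lambda>a b. \<pi> a * b) \<delta>" and ker: "\<And>i. i \<in> ker \<pi> \<Longrightarrow> \<delta> i = 0"
  shows "\<exists>\<delta>'. derivation (*) \<delta>' \<and> (\<forall>a. \<delta>' (\<pi> a) = \<delta> a)"
proof -
  note hom = complex_alg_hom_simps[OF \<pi>(1)]
  define \<delta>' where "\<delta>' b = \<delta> (inv \<pi> b)" for b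
  have \<delta>': "\<delta>' (\<pi> a) = \<delta> a" for a
  proof -
    have "\<pi> (inv \<pi> (\<pi> a) - a) + \<pi> a = \<pi> a"
      by (simp only: hom(1)[symmetric] diff_add_cancel surj_f_inv_f[OF \<pi>(2)])
    then have "inv \<pi> (\<pi> a) - a \<in> ker \<pi>" by (simp add: ker_def)
    then have "\<delta> (inv \<pi> (\<pi> a) - a) = 0" by (rule ker)
    then show ?thesis by (simp add: \<delta>'_def derivation_diff[OF \<delta>])
  qed
  have "derivation (*) \<delta>'"
  proof (rule derivationI)
    fix b b'
    obtain a a' where b: "b = \<pi> a" "b' = \<pi> a'" using \<pi>(2) by (meson surjD)
    show "\<delta>' (b + b') = \<delta>' b + \<delta>' b'"
      by (simp add: b hom(1)[symmetric] \<delta>' derivation_add[OF \<delta>])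
    show "\<delta>' (b * b') = b * \<delta>' b' + b' * \<delta>' b"
      by (simp add: b hom(2)[symmetric] \<delta>' derivation_mult[OF \<delta>])
  next
    fix c
    show "\<delta>' (of_cx c) = 0" using \<delta>'[of "of_cx c"] by (simp add: hom derivation_of_cx[OF \<delta>])
  qed
  then show ?thesis using \<delta>' by blast
qed

lemma zero_on_ideal_prod_ker:
  assumes \<pi>: "complex_alg_hom \<pi>" and add: "\<And>x y. D (x + y) = D x + D y"
    and prod: "\<And>f g. f \<in> ker \<pi> \<Longrightarrow> g \<in> ker \<pi> \<Longrightarrow> D (f * g) = (0::'g::ab_group_add)"
    and a: "a \<in> ideal_prod (ker \<pi>) (ker \<pi>)"
  shows "D a = 0"
  using a unfolding ideal_prod_def
proof (induction rule: module.span_induct_alt[OF module_mult, consumes 1, case_names base step])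
  case base
  show ?case using add[of 0 0] by simp
next
  case (step c x y)
  then obtain f g where x: "x = f * g" "f \<in> ker \<pi>" "g \<in> ker \<pi>" by blast
  then have "c * f \<in> ker \<pi>" by (simp add: ker_def complex_alg_hom_simps[OF \<pi>])
  then have "D (c * f * g) = 0" using x(3) by (rule prod)
  then show ?case using step(2) by (simp add: add x mult.assoc)
qed

section \<open>The restricted bivector field\<close>

lemma bivector_field_derivation:
  assumes \<pi>: "complex_alg_hom \<pi>" and P: "bivector_field P"
  shows "derivation (\<lambda>a b. \<pi> a * b) (\<lambda>a'. \<pi> (P (kd a) (kd a')))"
    and "derivation (\<lambda>a b. \<pi> a * b) (\<lambda>a. \<pi> (P (kd a) (kd a')))"
proof -
  have d: "derivation (\<lambda>a b. \<pi> a * b) (\<lambda>a. \<pi> (h (kd a)))" if "module_hom kscale (*) h" for h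
  proof -
    interpret H: module_hom kscale "(*)" h by (rule that)
    show ?thesis
      by (rule derivationI)
        (simp_all add: complex_alg_hom_simps[OF \<pi>] derivation_add[OF derivation_kd]
          derivation_mult[OF derivation_kd] derivation_of_cx[OF derivation_kd] H.add H.scale)
  qed
  show "derivation (\<lambda>a b. \<pi> a * b) (\<lambda>a'. \<pi> (P (kd a) (kd a')))"
    using P by (intro d) (simp add: bivector_field_def)
  show "derivation (\<lambda>a b. \<pi> a * b) (\<lambda>a. \<pi> (P (kd a) (kd a')))"
    using P by (intro d[of "\<lambda>v. P v (kd a')"]) (simp add: bivector_field_def)
qed

lemma bivector_field_antisym:
  assumes P: "bivector_field P"
  shows "P v w = - P w v"
proof -
  interpret L: module_hom kscale "(*)" "P u" for u using P by (simp add: bivector_field_def)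
  interpret R: module_hom kscale "(*)" "\<lambda>v. P v u" for u using P by (simp add: bivector_field_def)
  have "P (v + w) (v + w) = 0" "P v v = 0" "P w w = 0" using P by (simp_all add: bivector_field_def)
  then have "P v w + P w v = 0" by (simp add: L.add R.add add_ac)
  then show ?thesis by (simp add: eq_neg_iff_add_eq_0)
qed

text \<open>The dual basis splits the differentials of \<open>X\<close>, restricted to \<open>Y\<close>, into the conormal part and a
  copy of the differentials of \<open>Y\<close> spanned by the \<open>d (y j)\<close>: the conormal component of \<open>d a\<close> is
  \<open>d a - (\<Sum>j<n. \<theta> j (\<pi> a) d (y j))\<close>. Coisotropy says that two conormal components pair to zero, and the
  formula is this equation written out. In the proof, coisotropy enters through derivations of the form
  \<open>p P _ i\<close> with \<open>i \<in> I\<close>: they vanish on \<open>I\<close> and can therefore be expanded in the dual basis.\<close>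

lemma coisotropic_decomposition:
  fixes \<pi> :: "'a::complex_alg \<Rightarrow> 'b::complex_alg" and \<theta> :: "nat \<Rightarrow> 'b \<Rightarrow> 'b"
  defines "p \<equiv> \<lambda>P a a'. \<pi> (P (kd a) (kd a'))"
  assumes \<pi>: "complex_alg_hom \<pi>" "surj \<pi>" and P: "bivector_field P" "coisotropic \<pi> P"
    and \<theta>: "\<And>j. derivation (*) (\<theta> j)"
    and dual: "\<And>\<delta> b. derivation (*) \<delta> \<Longrightarrow> \<delta> b = (\<Sum>j<n. \<theta> j b * \<delta> (\<pi> (y j)))"
  shows "p P a a' = (\<Sum>k<n. \<theta> k (\<pi> a') * p P a (y k)) - (\<Sum>k<n. \<theta> k (\<pi> a) * p P a' (y k))
    - (\<Sum>k<n. \<theta> k (\<pi> a') * (\<Sum>j<n. \<theta> j (\<pi> a) * p P (y j) (y k)))"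
proof -
  have expand: "\<delta> c = (\<Sum>j<n. \<theta> j (\<pi> c) * \<delta> (y j))"
    if \<delta>: "derivation (\<lambda>a b. \<pi> a * b) \<delta>" "\<And>i. i \<in> ker \<pi> \<Longrightarrow> \<delta> i = 0" for \<delta> c
  proof -
    obtain \<delta>' where \<delta>': "derivation (*) \<delta>'" "\<And>a. \<delta>' (\<pi> a) = \<delta> a"
      using derivation_descends[OF \<pi> \<delta>] by blast
    show ?thesis using dual[OF \<delta>'(1), of "\<pi> c"] by (simp add: \<delta>'(2))
  qed
  have dp: "derivation (\<lambda>a b. \<pi> a * b) (p P c)" "derivation (\<lambda>a b. \<pi> a * b) (\<lambda>a. p P a c)" for c
    unfolding p_def by (rule bivector_field_derivation[OF \<pi>(1) P(1)])+
  have conormal: "p P f i = 0" if "f \<in> ker \<pi>" "i \<in> ker \<pi>" for f i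
    using P(2) that unfolding coisotropic_def p_def ker_def by blast
  \<comment> \<open>The pairing of the conormal component of \<open>d a\<close> with \<open>d c\<close>; being zero for \<open>c \<in> I\<close>, it can be
    expanded in \<open>c\<close> as well.\<close>
  define q where "q c = p P a c - (\<Sum>j<n. \<theta> j (\<pi> a) * p P (y j) c)" for c
  have "q i = 0" if "i \<in> ker \<pi>" for i
    using expand[OF dp(2) conormal[OF _ that], of a] by (simp add: q_def)
  moreover have "derivation (\<lambda>a b. \<pi> a * b) q"
    unfolding q_def
    by (intro derivation_diff_fun dp derivation_lincomb[of "(*)"] module_mult
        module_restrict_scalars[OF \<pi>(1), of "(*)"])
  ultimately have "q a' = (\<Sum>k<n. \<theta> k (\<pi> a') * q (y k))" by (intro expand)
  then have "p P a a' - (\<Sum>j<n. \<theta> j (\<pi> a) * p P (y j) a')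
    = (\<Sum>k<n. \<theta> k (\<pi> a') * p P a (y k))
      - (\<Sum>k<n. \<theta> k (\<pi> a') * (\<Sum>j<n. \<theta> j (\<pi> a) * p P (y j) (y k)))"
    by (simp add: q_def right_diff_distrib sum_subtractf)
  moreover have "p P (y j) a' = - p P a' (y j)" for j
  proof -
    have "p P (y j) a' + p P a' (y j) = 0"
      unfolding p_def by (subst bivector_field_antisym[OF P(1)])
        (simp add: complex_alg_hom_simps(1)[OF \<pi>(1), symmetric] complex_alg_hom_simps(4)[OF \<pi>(1)])
    then show ?thesis by (simp add: eq_neg_iff_add_eq_0)
  qed
  ultimately show ?thesis by (simp add: sum_negf algebra_simps)
qed

section \<open>The deformation cocycle\<close>

text \<open>For \<open>f, g \<in> I\<close> all terms of the cocycle equation except \<open>\<alpha> (f * g) l\<close> contain \<open>\<pi> f\<close>, \<open>\<pi> g\<close> or the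
  bracket of \<open>f\<close> and \<open>g\<close>, which lies in \<open>I\<close>.\<close>

lemma alpha_L_zero_on_ideal_square:
  assumes \<pi>: "complex_alg_hom \<pi>" and P: "coisotropic \<pi> P" and s: "module s"
    and \<alpha>: "is_alpha_L \<pi> P s \<alpha>" and a: "a \<in> ideal_prod (ker \<pi>) (ker \<pi>)"
  shows "\<alpha> a l = 0"
proof (rule zero_on_ideal_prod_ker[OF \<pi> _ _ a, of "\<lambda>a. \<alpha> a l"])
  interpret S: module s by (rule s)
  show "\<alpha> (x + y) l = \<alpha> x l + \<alpha> y l" for x y
    using \<alpha> linear_of_cx_iff[OF module_mult s, of "\<lambda>a. \<alpha> a l"] by (simp add: is_alpha_L_def)
  fix f g assume fg: "f \<in> ker \<pi>" "g \<in> ker \<pi>"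
  have "\<alpha> f (0 + 0) = \<alpha> f 0 + \<alpha> f 0"
    using \<alpha> linear_of_cx_iff[OF s s, of "\<alpha> f"] unfolding is_alpha_L_def by blast
  moreover have "\<alpha> (f * g) l - \<alpha> f (s (\<pi> g) l) + s (\<pi> (alpha_X P f g)) l - s (\<pi> f) (\<alpha> g l) = 0"
    using \<alpha> by (simp add: is_alpha_L_def)
  moreover have "\<pi> (alpha_X P f g) = 0"
    using P fg by (simp add: alpha_X_def complex_alg_hom_simps[OF \<pi>] coisotropic_def ker_def)
  ultimately show "\<alpha> (f * g) l = 0" using fg by (simp add: ker_def)
qed

text \<open>\<open>R\<close> combines covariant derivatives \<open>D k\<close> along \<open>\<theta> k\<close> with the coefficients \<open>\<sigma> k\<close>. The commutator of
  \<open>R a\<close> with \<open>\<pi> a'\<close> is then multiplication by \<open>\<Sum>k<n. \<sigma> k a * \<theta> k (\<pi> a')\<close>. In \<open>\<sigma>\<close> the second term is chosen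
  such that the antisymmetric part of this biderivation is half the bivector field; here the
  decomposition of a coisotropic bivector field is used. The symmetric part is \<open>Q\<close>, the defect of the
  product rule for \<open>\<psi>\<close>.\<close>

lemma deformation_data_exist:
  fixes \<pi> :: "'a::complex_alg \<Rightarrow> 'b::complex_alg"
    and s :: "'b \<Rightarrow> 'l::ab_group_add \<Rightarrow> 'l"
  assumes B: "smooth_affine TYPE('b)" and \<pi>: "complex_alg_hom \<pi>" "surj \<pi>"
    and P: "bivector_field P" "coisotropic \<pi> P" and L: "line_bundle s"
  shows "\<exists>\<psi> R. \<psi> \<in> diff_ops0 2 (\<lambda>a b. \<pi> a * b) UNIV \<and>
    derivation (\<lambda>a. op_scale s (\<pi> a)) R \<and> range R \<subseteq> diff_ops 1 s s \<and>
    is_alpha_L \<pi> P s (\<lambda>a l. s (\<psi> a) l + R a l) \<and>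
    (\<forall>a \<in> ideal_prod (ker \<pi>) (ker \<pi>). \<psi> a = 0 \<and> R a = 0)"
proof -
  have s: "module s" using L by (simp add: line_bundle_def)
  interpret S: module s by (rule s)
  have \<pi>mod: "module (\<lambda>a b. \<pi> a * b)" by (rule module_restrict_scalars[OF \<pi>(1) module_mult])
  note hom = complex_alg_hom_simps[OF \<pi>(1)]
  obtain n :: nat and x and \<theta> :: "nat \<Rightarrow> 'b \<Rightarrow> 'b" where \<theta>: "\<And>j. derivation (*) (\<theta> j)"
    and dual: "\<And>\<delta> b. derivation (*) \<delta> \<Longrightarrow> \<delta> b = (\<Sum>j<n. \<theta> j b * \<delta> (x j))"
    using smooth_affine_dual_basis[OF B] by blast
  define y where "y j = inv \<pi> (x j)" for j
  have y: "\<pi> (y j) = x j" for j by (simp add: y_def surj_f_inv_f[OF \<pi>(2)])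
  have "\<forall>k. \<exists>D. (\<forall>l l'. D (l + l') = D l + D l') \<and> (\<forall>b l. D (s b l) = s b (D l) + s (\<theta> k b) l)"
    using line_bundle_connection[OF L \<theta>] by blast
  then obtain D where D: "\<forall>k. (\<forall>l l'. D k (l + l') = D k l + D k l') \<and>
      (\<forall>b l. D k (s b l) = s b (D k l) + s (\<theta> k b) l)"
    by (rule choice[THEN exE])
  have D_add: "D k (l + l') = D k l + D k l'" and D_scale: "D k (s b l) = s b (D k l) + s (\<theta> k b) l"
    for k l l' b using D by simp_all
  define p where "p a a' = \<pi> (P (kd a) (kd a'))" for a a'
  define h where "h = (of_cx (1/2) :: 'b)"
  have half: "h * b + h * b = b" for b
    using of_cx_add[of "1/2" "1/2", where ?'a = 'b] by (simp add: h_def of_cx_1 flip: distrib_right)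
  have dp: "derivation (\<lambda>a b. \<pi> a * b) (\<lambda>a. p a c)" for c
    unfolding p_def by (rule bivector_field_derivation(2)[OF \<pi>(1) P(1)])
  have d\<theta>: "derivation (\<lambda>a b. \<pi> a * b) (\<lambda>a. \<theta> k (\<pi> a))" for k
    by (rule derivation_comp_hom[OF \<pi>(1) \<theta>])
  define \<sigma> where "\<sigma> k a = p a (y k) - h * (\<Sum>j<n. p (y j) (y k) * \<theta> j (\<pi> a))" for k a
  have d\<sigma>: "derivation (\<lambda>a b. \<pi> a * b) (\<sigma> k)" for k
  proof -
    have "derivation (\<lambda>a b. \<pi> a * b) (\<lambda>a. p a (y k) - (\<Sum>j<n. (h * p (y j) (y k)) * \<theta> j (\<pi> a)))"
      by (intro derivation_diff_fun dp d\<theta> derivation_lincomb[of "(*)"] module_mult \<pi>mod)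
    moreover have "\<sigma> k = (\<lambda>a. p a (y k) - (\<Sum>j<n. (h * p (y j) (y k)) * \<theta> j (\<pi> a)))"
      by (rule ext) (simp add: \<sigma>_def sum_distrib_left mult.assoc)
    ultimately show ?thesis by (simp only:)
  qed
  define Q where "Q a a' = h * ((\<Sum>k<n. p a (y k) * \<theta> k (\<pi> a')) + (\<Sum>k<n. \<theta> k (\<pi> a) * p a' (y k)))"
    for a a'
  define \<psi> where "\<psi> a = h * (\<Sum>k<n. \<theta> k (p a (y k)))" for a
  define R where "R a = (\<lambda>l. \<Sum>k<n. s (\<sigma> k a) (D k l))" for a

  \<comment> \<open>In terms of \<open>V\<close> and \<open>T\<close> below the left-hand side is \<open>V a a' - T / 2\<close>, and the bivector field is
    \<open>V a a' - V a' a - T\<close>; what remains after subtracting half of it is symmetric.\<close>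
  have symbol: "(\<Sum>k<n. \<sigma> k a * \<theta> k (\<pi> a')) = Q a a' + h * p a a'" for a a'
  proof -
    define V where "V a a' = (\<Sum>k<n. \<theta> k (\<pi> a') * p a (y k))" for a a'
    define T where "T = (\<Sum>k<n. \<theta> k (\<pi> a') * (\<Sum>j<n. \<theta> j (\<pi> a) * p (y j) (y k)))"
    have p: "p a a' = V a a' - V a' a - T"
      unfolding V_def T_def p_def
      by (rule coisotropic_decomposition[OF \<pi> P \<theta>]) (simp add: y, rule dual)
    have Q: "Q a a' = h * (V a a' + V a' a)"
      by (simp add: Q_def V_def mult.commute)
    have S: "(\<Sum>k<n. \<sigma> k a * \<theta> k (\<pi> a')) = V a a' - h * T"
      by (simp add: \<sigma>_def V_def T_def left_diff_distrib right_diff_distrib sum_subtractf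
          sum_distrib_left mult_ac)
    have "Q a a' + h * p a a' = (h * V a a' + h * V a a') - h * T"
      unfolding Q p by (simp add: algebra_simps)
    then show ?thesis by (simp add: S half)
  qed
  have \<psi>_add: "\<psi> (a + b) = \<psi> a + \<psi> b" for a b
    by (simp add: \<psi>_def derivation_add[OF dp] derivation_add[OF \<theta>] sum.distrib distrib_left)
  have \<psi>_mult: "\<psi> (a * b) = \<pi> a * \<psi> b + \<pi> b * \<psi> a + Q a b" for a b
    by (simp add: \<psi>_def Q_def derivation_mult[OF dp] derivation_add[OF \<theta>] derivation_mult[OF \<theta>]
        sum.distrib sum_distrib_left algebra_simps)
  have \<psi>_const: "\<psi> (of_cx c) = 0" for c
    by (simp add: \<psi>_def derivation_of_cx[OF dp] derivation_0[OF \<theta>])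
  have Q_const: "Q (of_cx c) b = 0" for c b
    by (simp add: Q_def derivation_of_cx[OF dp] hom derivation_of_cx[OF \<theta>])
  have Q_ker: "Q f g = 0" if "f \<in> ker \<pi>" "g \<in> ker \<pi>" for f g
    using that by (simp add: Q_def ker_def derivation_0[OF \<theta>])
  have dQ: "derivation (\<lambda>a b. \<pi> a * b) (Q a)" for a
    by (rule derivationI)
      (simp_all add: Q_def derivation_add[OF dp] derivation_add[OF d\<theta>] derivation_mult[OF dp]
        derivation_mult[OF d\<theta>] derivation_of_cx[OF dp] derivation_of_cx[OF d\<theta>]
        sum.distrib sum_distrib_left algebra_simps)
  have \<psi>: "\<psi> \<in> diff_ops0 2 (\<lambda>a b. \<pi> a * b) UNIV"
    using second_order_in_diff_ops[OF \<pi>mod \<psi>_add \<psi>_mult \<psi>_const Q_const dQ] \<psi>_const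
    by (simp add: diff_ops0_def)

  have R_add: "R (a + b) l = R a l + R b l" for a b l
    by (simp add: R_def derivation_add[OF d\<sigma>] S.scale_left_distrib sum.distrib)
  have R_mult: "R (a * b) l = s (\<pi> a) (R b l) + s (\<pi> b) (R a l)" for a b l
    by (simp add: R_def derivation_mult[OF d\<sigma>] S.scale_left_distrib sum.distrib S.scale_sum_right)
  have R_const: "R (of_cx c) l = 0" for c l
    by (simp add: R_def derivation_of_cx[OF d\<sigma>])
  have dR: "derivation (\<lambda>a. op_scale s (\<pi> a)) R"
    by (rule derivationI) (simp_all add: fun_eq_iff R_add R_mult R_const op_scale_def)
  have R_symbol: "R a (s b l) = s b (R a l) + s (\<Sum>k<n. \<sigma> k a * \<theta> k b) l" for a b l
    by (simp add: R_def D_scale S.scale_right_distrib sum.distrib S.scale_sum_right S.scale_sum_left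
        mult.commute)
  have R_linear: "R a (l + l') = R a l + R a l'" "R a (s (of_cx c) l) = s (of_cx c) (R a l)" for a c l l'
    by (simp_all add: R_symbol derivation_of_cx[OF \<theta>])
      (simp add: R_def D_add S.scale_right_distrib sum.distrib)
  have R: "R a \<in> diff_ops 1 s s" for a
  proof -
    have "(\<lambda>l. R a (s b l) - s b (R a l)) \<in> diff_ops 0 s s" for b
      using scale_in_diff_ops[OF s] by (simp add: R_symbol del: diff_ops.simps)
    then show ?thesis
      by (simp del: diff_ops.simps(1) add: linear_of_cx_iff[OF s s] R_linear)
  qed

  have "is_alpha_L \<pi> P s (\<lambda>a l. s (\<psi> a) l + R a l)"
    unfolding is_alpha_L_def linear_of_cx_iff[OF module_mult s] linear_of_cx_iff[OF s s]
  proof (intro conjI allI)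
    fix a b l c l'
    show "s (\<psi> (a + b)) l + R (a + b) l = s (\<psi> a) l + R a l + (s (\<psi> b) l + R b l)"
      by (simp add: \<psi>_add R_add S.scale_left_distrib)
    show "s (\<psi> (of_cx c * a)) l + R (of_cx c * a) l = s (of_cx c) (s (\<psi> a) l + R a l)"
      by (simp add: \<psi>_mult \<psi>_const Q_const R_mult R_const hom S.scale_right_distrib)
    show "s (\<psi> a) (l + l') + R a (l + l') = s (\<psi> a) l + R a l + (s (\<psi> a) l' + R a l')"
      by (simp add: R_linear S.scale_right_distrib)
    show "s (\<psi> a) (s (of_cx c) l) + R a (s (of_cx c) l) = s (of_cx c) (s (\<psi> a) l + R a l)"
      by (simp add: R_linear S.scale_right_distrib mult.commute)
    have "\<pi> (alpha_X P a b) = h * p a b" by (simp add: alpha_X_def hom h_def p_def)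
    then show "s (\<psi> (a * b)) l + R (a * b) l - (s (\<psi> a) (s (\<pi> b) l) + R a (s (\<pi> b) l))
        + s (\<pi> (alpha_X P a b)) l - s (\<pi> a) (s (\<psi> b) l + R b l) = 0"
      by (simp add: \<psi>_mult R_mult R_symbol symbol S.scale_left_distrib S.scale_right_distrib
          mult.commute)
  qed
  moreover have "\<psi> a = 0 \<and> R a = 0" if a: "a \<in> ideal_prod (ker \<pi>) (ker \<pi>)" for a
  proof
    show "\<psi> a = 0"
      by (rule zero_on_ideal_prod_ker[OF \<pi>(1) \<psi>_add _ a]) (simp add: \<psi>_mult Q_ker, simp add: ker_def)
    show "R a = 0"
      by (rule zero_on_ideal_prod_ker[OF \<pi>(1) _ _ a])
        (simp_all add: derivation_add[OF dR] derivation_mult[OF dR] ker_def op_scale_def fun_eq_iff)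
  qed
  ultimately show ?thesis using \<psi> dR R by blast
qed

theorem theorem3:
  fixes \<pi> :: "'a::complex_alg \<Rightarrow> 'b::complex_alg"
    and P :: "'a kaehler \<Rightarrow> 'a kaehler \<Rightarrow> 'a"
    and sL :: "'b \<Rightarrow> 'l::ab_group_add \<Rightarrow> 'l"
  assumes "smooth_affine TYPE('a)"
    and "smooth_affine TYPE('b)"
    and "complex_alg_hom \<pi>" and "surj \<pi>"
    and "bivector_field P"
    and "coisotropic \<pi> P"
    and "line_bundle sL"
  shows "(\<exists>\<alpha>. is_alpha_L \<pi> P sL \<alpha>) \<and>
    (\<forall>\<alpha>. is_alpha_L \<pi> P sL \<alpha> \<longrightarrow>
       (\<forall>a \<in> ideal_prod (ker \<pi>) (ker \<pi>). \<forall>l. \<alpha> a l = 0)) \<and>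
    bij_betw (\<lambda>\<psi> a l. sL (\<psi> a) l)
      (diff_ops0 2 (\<lambda>a b. \<pi> a * b) UNIV)
      (diff_ops0 2 (\<lambda>a. op_scale sL (\<pi> a)) (diff_ops 0 sL sL)) \<and>
    bij_betw (\<lambda>\<rho> a. \<rho> (kd_res \<pi> a))
      (hom_kres \<pi> (op_scale sL) (diff_ops 1 sL sL))
      (diff_ops0 1 (\<lambda>a. op_scale sL (\<pi> a)) (diff_ops 1 sL sL)) \<and>
    (\<exists>\<psi> \<in> diff_ops0 2 (\<lambda>a b. \<pi> a * b) UNIV.
     \<exists>\<rho> \<in> hom_kres \<pi> (op_scale sL) (diff_ops 1 sL sL).
       is_alpha_L \<pi> P sL (\<lambda>a l. sL (\<psi> a) l + \<rho> (kd_res \<pi> a) l) \<and>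
       (\<forall>a \<in> ideal_prod (ker \<pi>) (ker \<pi>). \<psi> a = 0 \<and> \<rho> (kd_res \<pi> a) = 0))"
proof -
  note B = assms(2) and \<pi> = assms(3,4) and P = assms(5,6) and L = assms(7)
  have s: "module sL" using L by (simp add: line_bundle_def)
  have bij_\<rho>: "bij_betw (\<lambda>\<rho> a. \<rho> (kd_res \<pi> a)) (hom_kres \<pi> (op_scale sL) (diff_ops 1 sL sL))
      (diff_ops0 1 (\<lambda>a. op_scale sL (\<pi> a)) (diff_ops 1 sL sL))"
    by (rule bij_betw_hom_kres_derivations[OF \<pi>(1) module_op_scale[OF s] subspace_diff_ops[OF s]])
  obtain \<psi> R where \<psi>: "\<psi> \<in> diff_ops0 2 (\<lambda>a b. \<pi> a * b) UNIV"
    and R: "derivation (\<lambda>a. op_scale sL (\<pi> a)) R" "range R \<subseteq> diff_ops 1 sL sL"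
    and \<alpha>: "is_alpha_L \<pi> P sL (\<lambda>a l. sL (\<psi> a) l + R a l)"
    and zero: "\<forall>a \<in> ideal_prod (ker \<pi>) (ker \<pi>). \<psi> a = 0 \<and> R a = 0"
    using deformation_data_exist[OF B \<pi> P L] by (elim exE conjE) (rule that)
  have "R \<in> diff_ops0 1 (\<lambda>a. op_scale sL (\<pi> a)) (diff_ops 1 sL sL)"
    using R by (simp only: diff_ops0_1[OF module_restrict_scalars[OF \<pi>(1) module_op_scale[OF s]]]
        mem_Collect_eq simp_thms)
  then have "R \<in> (\<lambda>\<rho> a. \<rho> (kd_res \<pi> a)) ` hom_kres \<pi> (op_scale sL) (diff_ops 1 sL sL)"
    using bij_betw_imp_surj_on[OF bij_\<rho>] by (simp only:)
  then obtain \<rho> where \<rho>: "\<rho> \<in> hom_kres \<pi> (op_scale sL) (diff_ops 1 sL sL)"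
    and R_eq: "R = (\<lambda>a. \<rho> (kd_res \<pi> a))"
    by (elim imageE) (rule that)
  show ?thesis
  proof (intro conjI)
    show "\<exists>\<alpha>. is_alpha_L \<pi> P sL \<alpha>" by (rule exI, rule \<alpha>)
    show "\<forall>\<alpha>. is_alpha_L \<pi> P sL \<alpha> \<longrightarrow> (\<forall>a \<in> ideal_prod (ker \<pi>) (ker \<pi>). \<forall>l. \<alpha> a l = 0)"
      by (intro allI impI ballI alpha_L_zero_on_ideal_square[OF \<pi>(1) P(2) s])
    show "\<exists>\<psi> \<in> diff_ops0 2 (\<lambda>a b. \<pi> a * b) UNIV.
     \<exists>\<rho> \<in> hom_kres \<pi> (op_scale sL) (diff_ops 1 sL sL).
       is_alpha_L \<pi> P sL (\<lambda>a l. sL (\<psi> a) l + \<rho> (kd_res \<pi> a) l) \<and>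
       (\<forall>a \<in> ideal_prod (ker \<pi>) (ker \<pi>). \<psi> a = 0 \<and> \<rho> (kd_res \<pi> a) = 0)"
      using \<alpha> zero unfolding R_eq by (intro bexI[OF _ \<psi>] bexI[OF _ \<rho>] conjI)
  qed (rule bij_betw_line_bundle_multipliers[OF \<pi>(1) L] bij_\<rho>)+
qed

end
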